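(* Let $k$ be a field, let $d\ge3$ be an integer and let $G$ be a graph on $[n]$. Then for all $s\ge1$, $$\operatorname{reg}(S/L_G(d)^s)\ \ge\ 2(s-1)+\max\{\mathfrak t(G),\mathfrak u(G)\}.$$
   Context: Graphs are finite, simple and undirected, with vertex set $V(G)=[n]=\{1,\dots,n\}$ and edge set $E(G)$. $\Delta(H)$ is the maximal degree of a vertex of $H$. A graph is unicyclic if it contains precisely one cycle as a subgraph. For a field $k$ and $d\ge1$, the LSS-ideal of $G$ is $$L_G(d)=\Big(f_e^{(d)}=\sum_{\ell=1}^d x_{i\ell}x_{j\ell}\ :\ e=\{i,j\}\in E(G)\Big)\subset S=k[x_{ij}: i\in[n],\ j\in[d]],$$ with $S$ standard graded. For a finitely generated graded $S$-module $M$, $\operatorname{reg}(M)=\max\{j-i:\operatorname{Tor}_i^S(M,k)_j\ne0\}$. For $d\ge3$ define $\mathfrak t(G)=\max\{|E(H)| : H$ is an induced subgraph of $G$ that is a forest with $\Delta(H)\le d\}$ and $\mathfrak u(G)=\max\{|E(H)| : H$ is an induced subgraph of $G$ that is a unicyclic graph with $\Delta(H)\le d\}$ (if there is no such $H$, the term $\mathfrak u(G)$ is disregarded).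
   Formalization: The formal statement assumes that G has at least one edge or s = 1; for an edgeless G and s ≥ 2, L_G(d) = 0 and t(G) = 0, so the printed inequality would read 0 ≥ 2(s−1), which is false. *)

theory Defs
  imports
    Complex_Main
    "HOL-Library.Cardinality"
    "HOL-Library.Poly_Mapping"
    "HOL-Library.Extended_Real"
begin

section \<open>Graphs\<close>

text \<open>
  The vertex set is a whole finite type, playing the role of \<open>[n]\<close>; a graph on it is given by
  its set of edges. The subgraph induced by a vertex set \<open>W\<close> has edge set \<open>induced_edges E W\<close>.
\<close>

definition simple_graph :: "'v set set \<Rightarrow> bool" where
  "simple_graph E \<longleftrightarrow> (\<forall>e\<in>E. card e = 2)"

definition induced_edges :: "'v set set \<Rightarrow> 'v set \<Rightarrow> 'v set set" where
  "induced_edges E W = {e \<in> E. e \<subseteq> W}"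

definition degree :: "'v set set \<Rightarrow> 'v \<Rightarrow> nat" where
  "degree E v = card {e \<in> E. v \<in> e}"

definition max_degree :: "'v set \<Rightarrow> 'v set set \<Rightarrow> nat" where
  "max_degree W E = Max (degree E ` W)"

definition cycle_edges :: "'v list \<Rightarrow> 'v set set" where
  "cycle_edges vs = {{vs ! i, vs ! (Suc i mod length vs)} | i. i < length vs}"

text \<open>
  A cycle subgraph is identified with its edge set, so that the different closed walks around
  one and the same cycle are not counted separately.
\<close>

definition cycles :: "'v set set \<Rightarrow> 'v set set set" where
  "cycles E = {cycle_edges vs | vs. 3 \<le> length vs \<and> distinct vs \<and> cycle_edges vs \<subseteq> E}"

definition forest :: "'v set set \<Rightarrow> bool" where
  "forest E \<longleftrightarrow> cycles E = {}"

definition unicyclic :: "'v set set \<Rightarrow> bool" where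
  "unicyclic E \<longleftrightarrow> (\<exists>!C. C \<in> cycles E)"

definition forest_sizes :: "nat \<Rightarrow> 'v::finite set set \<Rightarrow> nat set" where
  "forest_sizes d E = {card (induced_edges E W) | W. W \<noteq> {} \<and>
     forest (induced_edges E W) \<and> max_degree W (induced_edges E W) \<le> d}"

definition unicyclic_sizes :: "nat \<Rightarrow> 'v::finite set set \<Rightarrow> nat set" where
  "unicyclic_sizes d E = {card (induced_edges E W) | W. W \<noteq> {} \<and>
     unicyclic (induced_edges E W) \<and> max_degree W (induced_edges E W) \<le> d}"

definition t_inv :: "nat \<Rightarrow> 'v::finite set set \<Rightarrow> nat" where
  "t_inv d E = Max (forest_sizes d E)"

text \<open>Only meaningful if \<open>unicyclic_sizes d E\<close> is nonempty.\<close>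

definition u_inv :: "nat \<Rightarrow> 'v::finite set set \<Rightarrow> nat" where
  "u_inv d E = Max (unicyclic_sizes d E)"

definition max_t_u :: "nat \<Rightarrow> 'v::finite set set \<Rightarrow> nat" where
  "max_t_u d E =
    (if unicyclic_sizes d E = {} then t_inv d E else max (t_inv d E) (u_inv d E))"


section \<open>Polynomial rings and ideals\<close>

text \<open>Polynomials over \<open>'k\<close> whose variables are the elements of the type \<open>'x\<close>.\<close>

type_synonym ('x, 'k) mpoly = "('x \<Rightarrow>\<^sub>0 nat) \<Rightarrow>\<^sub>0 'k"

definition Var :: "'x \<Rightarrow> ('x, 'k::field) mpoly" where
  "Var x = Poly_Mapping.single (Poly_Mapping.single x 1) 1"

definition mon_degree :: "('x \<Rightarrow>\<^sub>0 nat) \<Rightarrow> nat" where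
  "mon_degree m = (\<Sum>x\<in>Poly_Mapping.keys m. Poly_Mapping.lookup m x)"

text \<open>The zero polynomial is homogeneous of every degree, and nothing else is homogeneous of
  negative degree.\<close>

definition homogeneous :: "int \<Rightarrow> ('x, 'k::field) mpoly \<Rightarrow> bool" where
  "homogeneous j p \<longleftrightarrow> (\<forall>m\<in>Poly_Mapping.keys p. int (mon_degree m) = j)"

definition irrelevant_ideal :: "('x, 'k::field) mpoly set" where
  "irrelevant_ideal = {p. Poly_Mapping.lookup p 0 = 0}"

definition ideal_gen :: "'a::comm_ring_1 set \<Rightarrow> 'a set" where
  "ideal_gen A = module.span (*) A"

primrec ideal_power :: "'a::comm_ring_1 set \<Rightarrow> nat \<Rightarrow> 'a set" where
  "ideal_power I 0 = UNIV"
| "ideal_power I (Suc s) = ideal_gen {a * b | a b. a \<in> I \<and> b \<in> ideal_power I s}"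

text \<open>The variable \<open>x\<^sub>i\<^sub>l\<close> is \<open>Var (i, l)\<close>; the second index ranges over the type \<open>'d\<close>, whose
  cardinality is the parameter \<open>d\<close> of the ideal.\<close>

definition lss_form :: "'v \<Rightarrow> 'v \<Rightarrow> ('v \<times> 'd::finite, 'k::field) mpoly" where
  "lss_form i j = (\<Sum>l\<in>UNIV. Var (i, l) * Var (j, l))"

definition LSS_ideal :: "'v set set \<Rightarrow> ('v \<times> 'd::finite, 'k::field) mpoly set" where
  "LSS_ideal E = ideal_gen {lss_form i j | i j. {i, j} \<in> E}"


section \<open>Graded free resolutions, Tor and regularity\<close>

text \<open>
  A sequence of graded free modules \<open>F\<^sub>i\<close> over the polynomial ring \<open>S\<close>, with homogeneous basis
  indexed by \<open>basis F i\<close>, together with \<open>S\<close>-linear maps given by the images of the basis elements: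
  \<^item> \<open>bdeg F i b\<close> is the degree of the basis element \<open>b\<close> of \<open>F\<^sub>i\<close>;
  \<^item> \<open>bdry F i b\<close>, an element of \<open>F\<^sub>i\<close>, is the image of the basis element \<open>b\<close> of \<open>F\<^sub>i\<^sub>+\<^sub>1\<close>;
  \<^item> \<open>aug F b\<close> represents the image in \<open>S/I\<close> of the basis element \<open>b\<close> of \<open>F\<^sub>0\<close>.
\<close>

record (overloaded) ('x, 'k) free_complex =
  basis :: "nat \<Rightarrow> nat set"
  bdeg :: "nat \<Rightarrow> nat \<Rightarrow> int"
  bdry :: "nat \<Rightarrow> nat \<Rightarrow> (nat \<Rightarrow>\<^sub>0 ('x, 'k::zero) mpoly)"
  aug :: "nat \<Rightarrow> ('x, 'k) mpoly"

definition free_mod :: "('x, 'k::field) free_complex \<Rightarrow> nat \<Rightarrow> (nat \<Rightarrow>\<^sub>0 ('x, 'k) mpoly) set" where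
  "free_mod F i = {v. Poly_Mapping.keys v \<subseteq> basis F i}"

definition homogeneous_elt ::
    "('x, 'k::field) free_complex \<Rightarrow> nat \<Rightarrow> int \<Rightarrow> (nat \<Rightarrow>\<^sub>0 ('x, 'k) mpoly) \<Rightarrow> bool" where
  "homogeneous_elt F i j v \<longleftrightarrow>
    (\<forall>b\<in>Poly_Mapping.keys v. homogeneous (j - bdeg F i b) (Poly_Mapping.lookup v b))"

definition smul :: "'a::comm_ring_1 \<Rightarrow> (nat \<Rightarrow>\<^sub>0 'a) \<Rightarrow> (nat \<Rightarrow>\<^sub>0 'a)" where
  "smul p v = Poly_Mapping.map (\<lambda>q. p * q) v"

definition bdry_map ::
    "('x, 'k::field) free_complex \<Rightarrow> nat \<Rightarrow> (nat \<Rightarrow>\<^sub>0 ('x, 'k) mpoly) \<Rightarrow> (nat \<Rightarrow>\<^sub>0 ('x, 'k) mpoly)" where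
  "bdry_map F i v = (\<Sum>b\<in>Poly_Mapping.keys v. smul (Poly_Mapping.lookup v b) (bdry F i b))"

definition aug_map ::
    "('x, 'k::field) free_complex \<Rightarrow> (nat \<Rightarrow>\<^sub>0 ('x, 'k) mpoly) \<Rightarrow> ('x, 'k) mpoly" where
  "aug_map F v = (\<Sum>b\<in>Poly_Mapping.keys v. Poly_Mapping.lookup v b * aug F b)"

text \<open>
  \<open>F\<close> is a graded free resolution of \<open>S/I\<close>, i.e. \<open>\<dots> \<rightarrow> F\<^sub>1 \<rightarrow> F\<^sub>0 \<rightarrow> S/I \<rightarrow> 0\<close> is an exact
  sequence of homogeneous maps of degree 0. It need not be minimal, nor are the ranks required
  to be finite.
\<close>

definition graded_free_resolution ::
    "('x, 'k::field) mpoly set \<Rightarrow> ('x, 'k) free_complex \<Rightarrow> bool" where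
  "graded_free_resolution I F \<longleftrightarrow>
    (\<forall>i. \<forall>b\<in>basis F (Suc i). bdry F i b \<in> free_mod F i \<and>
        homogeneous_elt F i (bdeg F (Suc i) b) (bdry F i b)) \<and>
    (\<forall>b\<in>basis F 0. homogeneous (bdeg F 0 b) (aug F b)) \<and>
    (\<forall>p. \<exists>v\<in>free_mod F 0. p - aug_map F v \<in> I) \<and>
    bdry_map F 0 ` free_mod F 1 = {v \<in> free_mod F 0. aug_map F v \<in> I} \<and>
    (\<forall>i. bdry_map F (Suc i) ` free_mod F (Suc (Suc i)) =
        {v \<in> free_mod F (Suc i). bdry_map F i v = 0})"

text \<open>
  With \<open>\<mm>\<close> the irrelevant ideal, \<open>F\<^sub>i \<otimes> k = F\<^sub>i / \<mm>F\<^sub>i\<close>, where \<open>\<mm>F\<^sub>i\<close> consists of the elements all of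
  whose coordinates lie in \<open>\<mm>\<close>. The cycles and boundaries of \<open>F \<otimes> k\<close> are described by their
  preimages in \<open>F\<close>.
\<close>

definition irrelevant_submod ::
    "('x, 'k::field) free_complex \<Rightarrow> nat \<Rightarrow> (nat \<Rightarrow>\<^sub>0 ('x, 'k) mpoly) set" where
  "irrelevant_submod F i =
    {v \<in> free_mod F i. \<forall>b. Poly_Mapping.lookup v b \<in> irrelevant_ideal}"

definition tensor_cycles ::
    "('x, 'k::field) free_complex \<Rightarrow> nat \<Rightarrow> (nat \<Rightarrow>\<^sub>0 ('x, 'k) mpoly) set" where
  "tensor_cycles F i = {v \<in> free_mod F i.
     case i of 0 \<Rightarrow> True | Suc i' \<Rightarrow> bdry_map F i' v \<in> irrelevant_submod F i'}"

definition tensor_boundaries ::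
    "('x, 'k::field) free_complex \<Rightarrow> nat \<Rightarrow> (nat \<Rightarrow>\<^sub>0 ('x, 'k) mpoly) set" where
  "tensor_boundaries F i =
    {bdry_map F i w + u | w u. w \<in> free_mod F (Suc i) \<and> u \<in> irrelevant_submod F i}"

text \<open>
  \<open>Tor\<^sub>i(S/I, k)\<^sub>j \<noteq> 0\<close>, i.e. \<open>H\<^sub>i(F \<otimes> k)\<^sub>j \<noteq> 0\<close>; up to isomorphism this does not depend on the
  resolution \<open>F\<close>.
\<close>

definition Tor_nonzero :: "('x, 'k::field) mpoly set \<Rightarrow> nat \<Rightarrow> int \<Rightarrow> bool" where
  "Tor_nonzero I i j \<longleftrightarrow> (\<exists>F. graded_free_resolution I F \<and>
     (\<exists>v \<in> tensor_cycles F i. homogeneous_elt F i j v \<and> v \<notin> tensor_boundaries F i))"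

text \<open>
  The regularity of \<open>S/I\<close> for a homogeneous ideal \<open>I\<close>, with the usual value \<open>-\<infinity>\<close> for \<open>S/I = 0\<close>.
  If \<open>'x\<close> is finite and \<open>I \<noteq> S\<close>, the supremum is over a nonempty finite set and hence a maximum.
\<close>

definition reg_quotient :: "('x, 'k::field) mpoly set \<Rightarrow> ereal" where
  "reg_quotient I = Sup {ereal (of_int (j - int i)) | i j. Tor_nonzero I i j}"

end

theory Submission
  imports Defs
begin

text \<open>
  Let \<open>L\<close> be the LSS-ideal of the graph, \<open>J = L\<^sup>s\<close>, and let \<open>H\<close> be an induced subgraph with \<open>e\<close> edges at
  which the maximum is attained. The bound follows from
  \<open>Tor\<^sub>e(S/J, k)\<^sub>j \<noteq> 0\<close> for \<open>j = 2(s - 1) + 2e\<close>, because then \<open>j - e = 2(s - 1) + e\<close>.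

  The class comes from the quadrics \<open>f\<^sub>1, ..., f\<^sub>e\<close> of the edges of \<open>H\<close>. Put \<open>g = f\<^sub>1\<^bsup>s-1\<^esup>\<close>. Every \<open>f\<^sub>a g\<close>
  lies in \<open>J\<close>, so multiplication by \<open>g\<close> extends to a chain map from the Koszul complex on
  \<open>f\<^sub>1, ..., f\<^sub>e\<close> to a graded free resolution \<open>F\<close> of \<open>S/J\<close>. The top basis element of the Koszul
  complex is sent to an element \<open>v\<close> of \<open>F\<^sub>e\<close> of degree \<open>2(s - 1) + 2e\<close>, and \<open>v\<close> is a cycle of
  \<open>F \<otimes> k\<close> since the \<open>f\<^sub>a\<close> have no constant term.

  To see that \<open>v\<close> is not a boundary, specialise the variables. A forest or unicyclic graph with
  degrees at most \<open>d\<close> has a proper edge colouring with \<open>d \<ge> 3\<close> colours and a weight on the edges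
  such that the weight of \<open>{u, v}\<close> exceeds the mean of the weights of any two other edges of
  one and the same colour, one at \<open>u\<close> and one at \<open>v\<close> (lemma \<open>concave_colouring_exists\<close>). Send
  \<open>x\<^sub>v\<^sub>l\<close> to a variable \<open>y\<^sub>h\<close> if \<open>h\<close> is the edge of \<open>H\<close> at \<open>v\<close> with colour \<open>l\<close>, and to \<open>0\<close> if there is
  none. This kills the quadrics of all edges outside \<open>H\<close>, and the quadric of \<open>h\<close> becomes \<open>y\<^sub>h\<^sup>2\<close>
  plus products \<open>y\<^sub>a y\<^sub>b\<close> of smaller weight. Such triangular quadrics behave like the squares of the
  variables: the products of squarefree monomials with monomials in the quadrics form a basis of the
  polynomial ring, and this basis is adapted to the powers of the ideal that the quadrics generate. Hence
  \<open>y\<^sub>1 \<cdots> y\<^sub>e g\<close> is not in the specialised ideal \<open>J\<close>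
  (lemma \<open>squarefree_times_power_notin\<close>).

  Order the edges by decreasing weight. Then \<open>f\<^sub>a\<close> is \<open>y\<^sub>a\<^sup>2\<close> modulo the later variables. If \<open>v\<close> were
  a boundary modulo the irrelevant ideal, one could apply the boundary map and cancel \<open>y\<^sub>1\<close>, then
  \<open>y\<^sub>2\<close>, and so on, descending from \<open>F\<^sub>e\<close> to \<open>F\<^sub>0\<close> (lemma \<open>climb\<close>); at \<open>F\<^sub>0\<close> this says that
  \<open>y\<^sub>1 \<cdots> y\<^sub>e g\<close> lies in the specialised ideal \<open>J\<close>, a contradiction.
\<close>

section \<open>Weighted edge colourings of forests and unicyclic graphs\<close>

lemma cycles_mono: "E' \<subseteq> E \<Longrightarrow> cycles E' \<subseteq> cycles E"
  unfolding cycles_def by blast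

lemma cycle_edges_subset: "C \<in> cycles E \<Longrightarrow> C \<subseteq> E"
  unfolding cycles_def by blast

lemma cycle_nonempty: "C \<in> cycles E \<Longrightarrow> C \<noteq> {}"
  unfolding cycles_def cycle_edges_def by fastforce

definition leafless :: "'v set set \<Rightarrow> bool" where
  "leafless E \<longleftrightarrow> (\<forall>e\<in>E. \<forall>v\<in>e. \<exists>e'\<in>E. e' \<noteq> e \<and> v \<in> e')"

lemma cycle_edge_inj:
  assumes "distinct vs" "3 \<le> length vs" "i < length vs" "j < length vs"
    and "{vs ! i, vs ! (Suc i mod length vs)} = {vs ! j, vs ! (Suc j mod length vs)}"
  shows "i = j"
proof (rule ccontr)
  assume "i \<noteq> j"
  have m: "Suc i mod length vs < length vs" "Suc j mod length vs < length vs"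
    using assms by (auto intro: mod_less_divisor)
  have "vs ! i \<noteq> vs ! j"
    using \<open>i \<noteq> j\<close> assms by (simp add: nth_eq_iff_index_eq)
  then have "vs ! i = vs ! (Suc j mod length vs)" "vs ! j = vs ! (Suc i mod length vs)"
    using assms(5) by (auto simp: doubleton_eq_iff)
  then have "i = Suc j mod length vs" "j = Suc i mod length vs"
    using assms m by (auto simp: nth_eq_iff_index_eq)
  moreover have "Suc k mod length vs = (if Suc k = length vs then 0 else Suc k)"
    if "k < length vs" for k using that by auto
  ultimately show False using assms(2-4) by (auto split: if_splits)
qed

text \<open>
  Consequently no edge of a cycle can be a leaf edge, so cycles survive the removal of leaf edges.
\<close>
lemma cycle_vertex_two_edges:
  assumes "C \<in> cycles E" "e \<in> C" "v \<in> e"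
  shows "\<exists>e'\<in>C. e' \<noteq> e \<and> v \<in> e'"
proof -
  obtain vs where vs: "C = cycle_edges vs" "3 \<le> length vs" "distinct vs"
    using assms(1) unfolding cycles_def by blast
  let ?m = "length vs"
  let ?e = "\<lambda>i. {vs ! i, vs ! (Suc i mod ?m)}"
  obtain i where i: "i < ?m" "e = ?e i" using assms(2) vs(1) unfolding cycle_edges_def by blast
  have inC: "?e j \<in> C" if "j < ?m" for j using that vs(1) unfolding cycle_edges_def by blast
  from assms(3) i consider "v = vs ! i" | "v = vs ! (Suc i mod ?m)" by blast
  then show ?thesis
  proof cases
    case 1
    define j where "j = (if i = 0 then ?m - 1 else i - 1)"
    have j: "j < ?m" "j \<noteq> i" "Suc j mod ?m = i"
      using i(1) vs(2) by (auto simp: j_def)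
    have "?e j \<noteq> e" using cycle_edge_inj[OF vs(3,2) j(1) i(1)] j(2) i(2) by blast
    moreover have "v \<in> ?e j" using 1 j(3) by simp
    ultimately show ?thesis using inC[OF j(1)] by (intro bexI[of _ "?e j"] conjI)
  next
    case 2
    define j where "j = Suc i mod ?m"
    have j: "j < ?m" "j \<noteq> i" using i(1) vs(2) by (auto simp: j_def mod_Suc)
    have "?e j \<noteq> e" using cycle_edge_inj[OF vs(3,2) j(1) i(1)] j(2) i(2) by blast
    moreover have "v \<in> ?e j" using 2 by (simp add: j_def)
    ultimately show ?thesis using inC[OF j(1)] by (intro bexI[of _ "?e j"] conjI)
  qed
qed

text \<open>
  The first vertex of a longest path has a second neighbour, which must lie on the path and
  closes a cycle.
\<close>
lemma leafless_has_cycle: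
  fixes E :: "'v::finite set set"
  assumes g: "simple_graph E" and l: "leafless E" and ne: "E \<noteq> {}"
  shows "cycles E \<noteq> {}"
proof -
  define P where "P = (\<lambda>vs. distinct vs \<and> 2 \<le> length vs \<and>
     (\<forall>i. Suc i < length vs \<longrightarrow> {vs ! i, vs ! Suc i} \<in> E))"
  obtain e where "e \<in> E" using ne by blast
  then obtain a b where "e = {a, b}" "a \<noteq> b" using g unfolding simple_graph_def
    by (meson card_2_iff)
  then have "P [a, b]" using \<open>e \<in> E\<close> by (auto simp: P_def)
  have bnd: "length vs \<le> CARD('v)" if "P vs" for vs
    using that card_mono[of UNIV "set vs"]
    by (auto simp: P_def distinct_card)
  then obtain vs where vs: "P vs" and mx: "\<And>ws. P ws \<Longrightarrow> length ws \<le> length vs"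
    using ex_has_greatest_nat[of P "[a,b]" length "Suc CARD('v)"] \<open>P [a,b]\<close>
    by (meson le_imp_less_Suc)
  have len: "2 \<le> length vs" and dist: "distinct vs"
    and path: "\<And>i. Suc i < length vs \<Longrightarrow> {vs ! i, vs ! Suc i} \<in> E"
    using vs by (auto simp: P_def)
  have e0: "{vs ! 0, vs ! 1} \<in> E" using path[of 0] len by simp
  then obtain e' where e': "e' \<in> E" "e' \<noteq> {vs ! 0, vs ! 1}" "vs ! 0 \<in> e'"
    using l unfolding leafless_def by blast
  have "card e' = 2" using e'(1) g unfolding simple_graph_def by blast
  then obtain x where x: "e' = {vs ! 0, x}" "x \<noteq> vs ! 0"
    using e'(3) by (metis card_2_iff doubleton_eq_iff insertE singletonD)
  have "x \<in> set vs"
  proof (rule ccontr)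
    assume "x \<notin> set vs"
    then have "P (x # vs)"
      using vs e'(1) x unfolding P_def
      by (auto simp: nth_Cons insert_commute split: nat.split)
    then show False using mx by fastforce
  qed
  then obtain j where j: "j < length vs" "x = vs ! j" by (auto simp: in_set_conv_nth)
  have "j \<noteq> 0" using j x by (metis)
  have "j \<noteq> 1" using e'(2) x j by auto
  define ws where "ws = take (Suc j) vs"
  have lw: "length ws = Suc j" using j by (simp add: ws_def)
  have "cycle_edges ws \<subseteq> E"
  proof
    fix h assume "h \<in> cycle_edges ws"
    then obtain i where i: "i < Suc j" "h = {ws ! i, ws ! (Suc i mod Suc j)}"
      unfolding cycle_edges_def lw by blast
    show "h \<in> E"
    proof (cases "i = j")
      case True
      then have "h = e'" using i x j by (auto simp: ws_def)
      then show ?thesis using e' by simp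
    next
      case False
      then have "Suc i < Suc j" using i by simp
      then have "h = {vs ! i, vs ! Suc i}" using i by (simp add: ws_def)
      then show ?thesis using path[of i] \<open>Suc i < Suc j\<close> j by simp
    qed
  qed
  moreover have "distinct ws" using dist by (simp add: ws_def)
  moreover have "3 \<le> length ws" using lw \<open>j \<noteq> 0\<close> \<open>j \<noteq> 1\<close> by simp
  ultimately show ?thesis unfolding cycles_def by blast
qed

lemma simple_graph_subset: "simple_graph E \<Longrightarrow> E' \<subseteq> E \<Longrightarrow> simple_graph E'"
  unfolding simple_graph_def by blast

lemma forest_card_edges:
  fixes E :: "'v::finite set set"
  assumes "simple_graph E" "forest E" "E \<noteq> {}"
  shows "card E < card (\<Union>E)"
  using assms
proof (induction "card E" arbitrary: E rule: less_induct)
  case less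
  have "\<not> leafless E" using leafless_has_cycle[of E] less.prems unfolding forest_def by blast
  then obtain e v where ev: "e \<in> E" "v \<in> e" "\<And>e'. e' \<in> E \<Longrightarrow> v \<in> e' \<Longrightarrow> e' = e"
    unfolding leafless_def by blast
  let ?E' = "E - {e}"
  have ce: "card e = 2" using less.prems ev unfolding simple_graph_def by blast
  show ?case
  proof (cases "?E' = {}")
    case True
    then have "E = {e}" using ev by blast
    then show ?thesis using ce by simp
  next
    case False
    have c: "card E = Suc (card ?E')" using ev(1) by (metis finite card_Suc_Diff1)
    have "forest ?E'" using less.prems(2) cycles_mono[of ?E' E] unfolding forest_def by blast
    then have "card ?E' < card (\<Union>?E')"
      using less.hyps[of ?E'] c False simple_graph_subset[OF less.prems(1)] by auto
    moreover have "\<Union>?E' \<subset> \<Union>E" using ev by blast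
    then have "card (\<Union>?E') < card (\<Union>E)" by (simp add: psubset_card_mono)
    ultimately show ?thesis using c by linarith
  qed
qed

lemma sum_degrees:
  fixes E :: "'v::finite set set"
  assumes "simple_graph E"
  shows "(\<Sum>v\<in>\<Union>E. degree E v) = 2 * card E"
proof -
  have "(\<Sum>v\<in>\<Union>E. degree E v) = (\<Sum>v\<in>\<Union>E. \<Sum>e\<in>E. if v \<in> e then 1 else 0)"
    unfolding degree_def by (simp add: sum.If_cases Int_def)
  also have "\<dots> = (\<Sum>e\<in>E. \<Sum>v\<in>\<Union>E. if v \<in> e then 1 else 0)" by (rule sum.swap)
  also have "\<dots> = (\<Sum>e\<in>E. card e)"
  proof (rule sum.cong[OF refl])
    fix e assume "e \<in> E"
    then have "\<Union>E \<inter> e = e" by blast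
    then show "(\<Sum>v\<in>\<Union>E. if v \<in> e then 1 else 0) = card e"
      by (simp add: sum.If_cases)
  qed
  also have "\<dots> = 2 * card E" using assms by (simp add: simple_graph_def)
  finally show ?thesis .
qed

lemma leafless_degree:
  fixes E :: "'v::finite set set"
  assumes "leafless E" "v \<in> \<Union>E"
  shows "2 \<le> degree E v"
proof -
  obtain e e' where "e \<in> E" "v \<in> e" "e' \<in> E" "e' \<noteq> e" "v \<in> e'"
    using assms unfolding leafless_def by blast
  then have "{e, e'} \<subseteq> {e \<in> E. v \<in> e}" by blast
  then have "card {e, e'} \<le> degree E v" unfolding degree_def by (intro card_mono) auto
  then show ?thesis using \<open>e' \<noteq> e\<close> by simp
qed

text \<open>
  Deleting an edge of the only cycle leaves a forest on the same vertices, which bounds the number of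
  edges by the number of vertices. As all degrees are at least two, they are all equal to two. So
  the edges outside the cycle do not meet it, they form again a leafless graph, and any such
  edge would give a second cycle.
\<close>
lemma leafless_unicyclic_is_cycle:
  fixes E :: "'v::finite set set"
  assumes g: "simple_graph E" and l: "leafless E" and C: "cycles E = {C}"
  shows "E = C"
proof (rule ccontr)
  assume neq: "E \<noteq> C"
  have CE: "C \<subseteq> E" and Cne: "C \<noteq> {}" using C cycle_edges_subset[of C E] cycle_nonempty[of C E] by simp_all
  obtain e where e: "e \<in> C" using Cne by blast
  have c: "card E = Suc (card (E - {e}))" using e CE by (metis finite card_Suc_Diff1 subsetD)
  have "cycles (E - {e}) = {}"
  proof -
    have "D = C" if "D \<in> cycles (E - {e})" for D using that cycles_mono[of "E - {e}" E] C by blast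
    moreover have "C \<notin> cycles (E - {e})" using cycle_edges_subset[of C "E - {e}"] e by blast
    ultimately show ?thesis by blast
  qed
  moreover have "E - {e} \<noteq> {}" using neq CE e by blast
  ultimately have "card (E - {e}) < card (\<Union>(E - {e}))"
    using forest_card_edges[of "E - {e}"] simple_graph_subset[OF g] unfolding forest_def by blast
  moreover have "card (\<Union>(E - {e})) \<le> card (\<Union>E)" by (intro card_mono) auto
  ultimately have le: "card E \<le> card (\<Union>E)" using c by linarith
  have deg: "degree E v = 2" if v: "v \<in> \<Union>E" for v
  proof (rule ccontr)
    assume "degree E v \<noteq> 2"
    then have "2 < degree E v" using leafless_degree[OF l v] by simp
    then have "(\<Sum>v\<in>\<Union>E. 2) < (\<Sum>v\<in>\<Union>E. degree E v)"
      using leafless_degree[OF l] v by (intro sum_strict_mono_ex1) auto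
    then show False using sum_degrees[OF g] le by simp
  qed
  have avoid: "v \<notin> \<Union>C" if h: "h \<in> E - C" "v \<in> h" for h v
  proof
    assume "v \<in> \<Union>C"
    then obtain e1 e2 where "e1 \<in> C" "v \<in> e1" "e2 \<in> C" "e2 \<noteq> e1" "v \<in> e2"
      using cycle_vertex_two_edges[of C E] C by blast
    moreover have "h \<noteq> e1" "h \<noteq> e2" using calculation h by blast+
    ultimately have "{h, e1, e2} \<subseteq> {e \<in> E. v \<in> e}" "card {h, e1, e2} = 3"
      using h CE by (blast, metis card_3_iff)
    then have "3 \<le> degree E v" unfolding degree_def
      by (metis card_mono finite)
    moreover have "v \<in> \<Union>E" using h by blast
    ultimately show False using deg[of v] by simp
  qed
  have "leafless (E - C)"
    unfolding leafless_def
  proof (intro ballI)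
    fix h v assume hv: "h \<in> E - C" "v \<in> h"
    then obtain h' where "h' \<in> E" "h' \<noteq> h" "v \<in> h'" using l unfolding leafless_def by blast
    moreover have "h' \<notin> C" using avoid[OF hv] \<open>v \<in> h'\<close> by blast
    ultimately show "\<exists>e'\<in>E - C. e' \<noteq> h \<and> v \<in> e'" by blast
  qed
  moreover have "E - C \<noteq> {}" using neq CE by blast
  ultimately obtain D where "D \<in> cycles (E - C)"
    using leafless_has_cycle[of "E - C"] simple_graph_subset[OF g, of "E - C"] by auto
  then have "D \<in> cycles E" "D \<subseteq> E - C" using cycles_mono[of "E - C" E] cycle_edges_subset[of D "E - C"] by blast+
  then show False using C Cne by blast
qed

text \<open>
  The quadric of the edge \<open>{u, v}\<close> contains, besides the term belonging to the colour of the edge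
  itself, a product of two variables for each pair of other edges of one colour at \<open>u\<close> and at \<open>v\<close>.
  The second condition makes the term of the edge itself strictly the heaviest.
\<close>
definition concave_colouring :: "'v set set \<Rightarrow> ('v set \<Rightarrow> 'c) \<Rightarrow> ('v set \<Rightarrow> nat) \<Rightarrow> bool" where
  "concave_colouring E c w \<longleftrightarrow>
    (\<forall>e\<in>E. \<forall>e'\<in>E. e \<noteq> e' \<longrightarrow> e \<inter> e' \<noteq> {} \<longrightarrow> c e \<noteq> c e') \<and>
    (\<forall>u v e\<^sub>1 e\<^sub>2. {u, v} \<in> E \<longrightarrow> e\<^sub>1 \<in> E - {{u, v}} \<longrightarrow> u \<in> e\<^sub>1 \<longrightarrow> e\<^sub>2 \<in> E - {{u, v}} \<longrightarrow> v \<in> e\<^sub>2 \<longrightarrow>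
       c e\<^sub>1 = c e\<^sub>2 \<longrightarrow> w e\<^sub>1 + w e\<^sub>2 < 2 * w {u, v})"

text \<open>
  The new edge takes a colour that is free at its inner end and gets a weight far below all others,
  so it only helps the inequalities of its neighbours; its own inequality is void, since
  no other edge ends in the leaf.
\<close>
lemma concave_colouring_add_leaf:
  fixes E :: "'v::finite set set" and c :: "'v set \<Rightarrow> 'd::finite"
  assumes g: "simple_graph E" and cc: "concave_colouring (E - {e}) c w"
    and e: "e \<in> E" "v \<in> e" and leaf: "\<And>e'. e' \<in> E \<Longrightarrow> v \<in> e' \<Longrightarrow> e' = e"
    and deg: "\<And>u. degree E u \<le> CARD('d)"
  shows "\<exists>(c' :: 'v set \<Rightarrow> 'd) w'. concave_colouring E c' w'"
proof -
  let ?E' = "E - {e}"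
  have "card e = 2" using g e unfolding simple_graph_def by blast
  then obtain u where u: "e = {u, v}" "u \<noteq> v" using e(2)
    by (metis card_2_iff doubleton_eq_iff insertE singletonD)
  have "card {h \<in> ?E'. u \<in> h} < card {h \<in> E. u \<in> h}"
    using e u by (intro psubset_card_mono) auto
  then have "card {h \<in> ?E'. u \<in> h} < CARD('d)" using deg[of u] unfolding degree_def by linarith
  then have "card (c ` {h \<in> ?E'. u \<in> h}) < CARD('d)"
    using card_image_le[of "{h \<in> ?E'. u \<in> h}" c] by (meson finite le_less_trans)
  then obtain k where k: "k \<notin> c ` {h \<in> ?E'. u \<in> h}"
    by (metis UNIV_eq_I less_irrefl)
  \<comment> \<open>Shifting all old weights by \<open>N\<close> keeps the old inequalities, which are between sums of two weights.\<close>
  define N where "N = Suc (\<Sum>h\<in>E. w h)"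
  have N: "w h < N" if "h \<in> E" for h
    using that member_le_sum[of h E w] by (simp add: N_def le_imp_less_Suc)
  let ?c = "c(e := k)" and ?w = "\<lambda>h. if h = e then 0 else w h + N"
  have "concave_colouring E ?c ?w"
    unfolding concave_colouring_def
  proof (intro conjI ballI allI impI)
    fix h h' assume h: "h \<in> E" "h' \<in> E" "h \<noteq> h'" "h \<inter> h' \<noteq> {}"
    have *: "c x \<noteq> k" if "x \<in> E" "x \<noteq> e" "e \<inter> x \<noteq> {}" for x
    proof -
      have "u \<in> x" using that leaf[of x] u by blast
      then show ?thesis using k that by blast
    qed
    show "?c h \<noteq> ?c h'"
      using h *[of h] *[of h'] cc unfolding concave_colouring_def
      by (auto simp: Int_commute)
  next
    fix a b e1 e2
    assume h: "{a, b} \<in> E" "e1 \<in> E - {{a, b}}" "a \<in> e1" "e2 \<in> E - {{a, b}}" "b \<in> e2"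
      and eq: "?c e1 = ?c e2"
    show "?w e1 + ?w e2 < 2 * ?w {a, b}"
    proof (cases "{a, b} = e")
      case True
      then have "a = v \<or> b = v" using u by (auto simp: doubleton_eq_iff)
      then have False using h leaf[of e1] leaf[of e2] True by blast
      then show ?thesis ..
    next
      case False
      show ?thesis
      proof (cases "e1 = e \<or> e2 = e")
        case True
        then show ?thesis using False N[of e1] N[of e2] h by auto
      next
        case F2: False
        then have "w e1 + w e2 < 2 * w {a, b}"
          using cc h eq False unfolding concave_colouring_def by auto
        then show ?thesis using False F2 by auto
      qed
    qed
  qed
  then show ?thesis by blast
qed

text \<open>
  On a cycle with two alternating colours the weights would have to be strictly concave all the way
  around, which is impossible. A third colour on one edge removes the condition at its two
  neighbours; the remaining edges form a path, on which \<open>m\<^sup>2 - i\<^sup>2\<close> is strictly concave, and the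
  special edge gets the largest weight.
\<close>
lemma concave_colouring_cycle:
  fixes C :: "'v set set"
  assumes C: "C \<in> cycles E" and d: "3 \<le> CARD('d::finite)"
  shows "\<exists>(c :: 'v set \<Rightarrow> 'd) w. concave_colouring C c w"
proof -
  obtain vs where vs: "C = cycle_edges vs" "3 \<le> length vs" "distinct vs"
    using C unfolding cycles_def by blast
  define m where "m = length vs"
  define ed where "ed i = {vs ! i, vs ! (Suc i mod m)}" for i
  have C_eq: "C = ed ` {..<m}" using vs(1) unfolding cycle_edges_def ed_def m_def by blast
  have inj: "i = j" if "ed i = ed j" "i < m" "j < m" for i j
    using cycle_edge_inj[OF vs(3,2)] that unfolding ed_def m_def by blast
  obtain D :: "'d set" where "card D = 3" using d obtain_subset_with_card_n by blast
  then obtain k0 k1 k2 :: 'd where k: "k0 \<noteq> k1" "k0 \<noteq> k2" "k1 \<noteq> k2"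
    by (metis card_3_iff)
  \<comment> \<open>The position of an edge on the cycle; \<open>ci\<close> and \<open>wi\<close> are the colour and the weight by position.\<close>
  define ix where "ix e = (THE i. i < m \<and> ed i = e)" for e
  have ix: "ix (ed i) = i" if "i < m" for i
    unfolding ix_def using that inj by (intro the_equality) auto
  define ci where "ci i = (if i = m - 1 then k2 else if even i then k0 else k1)" for i
  define wi where "wi i = (if i = m - 1 then m * m + 1 else m * m - i * i)" for i
  define nx where "nx i = Suc i mod m" for i
  have m3: "3 \<le> m" using vs(2) by (simp add: m_def)
  have vinj: "i = j" if "vs ! i = vs ! j" "i < m" "j < m" for i j
    using that vs(3) by (simp add: nth_eq_iff_index_eq m_def)
  have nxlt: "nx i < m" for i using m3 by (simp add: nx_def)
  have nx_if: "nx i = (if Suc i = m then 0 else Suc i)" if "i < m" for i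
    using that by (auto simp: nx_def)
  have nx_inj: "i = j" if "nx i = nx j" "i < m" "j < m" for i j
    using that by (auto simp: nx_if split: if_splits)
  have ed_nx: "ed i = {vs ! i, vs ! nx i}" for i by (simp add: ed_def nx_def)
  have meet: "j = i \<or> j = nx i \<or> i = nx j" if h: "ed i \<inter> ed j \<noteq> {}" "i < m" "j < m" for i j
  proof -
    have "vs ! i = vs ! j \<or> vs ! i = vs ! nx j \<or> vs ! nx i = vs ! j \<or> vs ! nx i = vs ! nx j"
      using h(1) unfolding ed_nx by blast
    then show ?thesis using vinj nxlt nx_inj h by metis
  qed
  have prev: "i = nx j" if "i < m" "j < m" "j \<noteq> i" "vs ! i \<in> ed j" for i j
    using that vinj[of i j] vinj[of i "nx j"] nxlt[of j] unfolding ed_nx by blast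
  have succ: "j = nx i" if "i < m" "j < m" "j \<noteq> i" "vs ! nx i \<in> ed j" for i j
    using that vinj[of "nx i" j] vinj[of "nx i" "nx j"] nxlt[of i] nxlt[of j] nx_inj[of i j]
    unfolding ed_nx by blast
  have proper: "ci i \<noteq> ci (nx i)" if "i < m" for i
    using that m3 k unfolding ci_def by (auto simp: nx_if split: if_splits)
  have conc: "wi p + wi (nx i) < 2 * wi i" if h: "i < m" "p < m" "i = nx p" "ci p = ci (nx i)" for i p
  proof -
    consider "i = m - 1" | "0 < i" "i < m - 2" | "i = 0" | "i = m - 2" "0 < i" using h(1) m3 by fastforce
    then show ?thesis
    proof cases
      case 1
      have "p \<noteq> m - 1" "nx i \<noteq> m - 1"
        using 1 h m3 by (auto simp: nx_if split: if_splits)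
      then have "wi p \<le> m * m" "wi (nx i) \<le> m * m" by (auto simp: wi_def)
      then show ?thesis using 1 by (simp add: wi_def)
    next
      case 2
      have p: "i = Suc p" using h 2 by (auto simp: nx_if split: if_splits)
      have n: "nx i = Suc i" using 2 by (simp add: nx_if)
      have "Suc i * Suc i \<le> m * m" using 2 by (intro mult_le_mono) auto
      moreover have "i * i = p * p + 2 * p + 1" "Suc i * Suc i = p * p + 4 * p + 4"
        using p by (simp_all add: algebra_simps)
      ultimately have "(m * m - p * p) + (m * m - Suc i * Suc i) < 2 * (m * m - i * i)"
        by linarith
      moreover have "p \<noteq> m - 1" "i \<noteq> m - 1" "Suc i \<noteq> m - 1" using 2 p by linarith+
      ultimately show ?thesis using n by (simp add: wi_def)
    next
      case 3
      have "p = m - 1" "nx i = 1" using h 3 m3 by (auto simp: nx_if split: if_splits)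
      then show ?thesis using h m3 k by (auto simp: ci_def split: if_splits)
    next
      case 4
      have "p = i - 1" "nx i = m - 1" using h 4 m3 by (auto simp: nx_if split: if_splits)
      then show ?thesis using h 4 m3 k by (auto simp: ci_def split: if_splits)
    qed
  qed
  have "concave_colouring C (ci \<circ> ix) (wi \<circ> ix)"
    unfolding concave_colouring_def
  proof (intro conjI ballI allI impI)
    fix h h' assume h: "h \<in> C" "h' \<in> C" "h \<noteq> h'" "h \<inter> h' \<noteq> {}"
    then obtain i j where ij: "h = ed i" "i < m" "h' = ed j" "j < m" unfolding C_eq by blast
    then have "j = nx i \<or> i = nx j" using meet[of i j] h by blast
    then show "(ci \<circ> ix) h \<noteq> (ci \<circ> ix) h'" using proper[of i] proper[of j] ij ix by auto
  next
    fix a b e1 e2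
    assume h: "{a, b} \<in> C" "e1 \<in> C - {{a, b}}" "a \<in> e1" "e2 \<in> C - {{a, b}}" "b \<in> e2"
      and eq: "(ci \<circ> ix) e1 = (ci \<circ> ix) e2"
    obtain i where i: "{a, b} = ed i" "i < m" using h(1) unfolding C_eq by blast
    obtain p where p: "e1 = ed p" "p < m" using h(2) unfolding C_eq by blast
    obtain q where q: "e2 = ed q" "q < m" using h(4) unfolding C_eq by blast
    have ne: "p \<noteq> i" "q \<noteq> i" using h i p q by auto
    have ceq: "ci p = ci q" using eq ix p q by simp
    have "{a, b} = {vs ! i, vs ! nx i}" using i by (simp add: ed_def nx_def)
    then consider "a = vs ! i" "b = vs ! nx i" | "b = vs ! i" "a = vs ! nx i"
      by (auto simp: doubleton_eq_iff)
    then have "wi p + wi q < 2 * wi i"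
    proof cases
      case 1
      then have "i = nx p" "q = nx i"
        using prev[OF i(2) p(2)] succ[OF i(2) q(2)] ne h p q by auto
      then show ?thesis using conc[of i p] i p ceq by simp
    next
      case 2
      then have "i = nx q" "p = nx i"
        using prev[OF i(2) q(2)] succ[OF i(2) p(2)] ne h p q by auto
      then show ?thesis using conc[of i q] i q ceq by simp
    qed
    then show "(wi \<circ> ix) e1 + (wi \<circ> ix) e2 < 2 * (wi \<circ> ix) {a, b}" using i p q ix by simp
  qed
  then show ?thesis by blast
qed

lemma degree_mono:
  fixes E :: "'v::finite set set"
  shows "E' \<subseteq> E \<Longrightarrow> degree E' v \<le> degree E v"
  unfolding degree_def by (intro card_mono) auto

lemma concave_colouring_peel:
  fixes E :: "'v::finite set set" and c\<^sub>0 :: "'v set \<Rightarrow> 'd::finite"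
  assumes "simple_graph E" "K \<subseteq> E"
    and leaf: "\<And>E'. K \<subset> E' \<Longrightarrow> E' \<subseteq> E \<Longrightarrow> \<exists>e\<in>E' - K. \<exists>v\<in>e. \<forall>e'\<in>E'. v \<in> e' \<longrightarrow> e' = e"
    and K: "concave_colouring K c\<^sub>0 w\<^sub>0"
    and deg: "\<And>u. degree E u \<le> CARD('d)"
  shows "\<exists>(c :: 'v set \<Rightarrow> 'd) w. concave_colouring E c w"
  using assms(1,2) leaf deg
proof (induction "card E" arbitrary: E rule: less_induct)
  case less
  show ?case
  proof (cases "E = K")
    case True
    then show ?thesis using K by blast
  next
    case False
    then obtain e v where ev: "e \<in> E - K" "v \<in> e" "\<And>e'. e' \<in> E \<Longrightarrow> v \<in> e' \<Longrightarrow> e' = e"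
      using less.prems(3)[of E] less.prems(2) by blast
    have "card (E - {e}) < card E" using ev(1) by (intro psubset_card_mono) auto
    moreover have "degree (E - {e}) u \<le> CARD('d)" for u
      using less.prems(4)[of u] degree_mono[of "E - {e}" E u] by (meson Diff_subset le_trans)
    moreover have "K \<subseteq> E - {e}" using less.prems(2) ev(1) by blast
    moreover have "simple_graph (E - {e})" using simple_graph_subset[OF less.prems(1)] by blast
    moreover have "\<exists>e\<in>E' - K. \<exists>v\<in>e. \<forall>e'\<in>E'. v \<in> e' \<longrightarrow> e' = e"
      if "K \<subset> E'" "E' \<subseteq> E - {e}" for E' using less.prems(3)[of E'] that by blast
    ultimately obtain c :: "'v set \<Rightarrow> 'd" and w where "concave_colouring (E - {e}) c w"
      using less.hyps[of "E - {e}"] by blast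
    then show ?thesis
      using concave_colouring_add_leaf[OF less.prems(1)] ev less.prems(4) by blast
  qed
qed

lemma concave_colouring_exists:
  fixes E :: "'v::finite set set"
  assumes g: "simple_graph E" and d: "3 \<le> CARD('d::finite)"
    and deg: "\<And>u. degree E u \<le> CARD('d)"
    and fu: "forest E \<or> unicyclic E"
  shows "\<exists>(c :: 'v set \<Rightarrow> 'd) w. concave_colouring E c w"
  using fu
proof
  assume f: "forest E"
  have "concave_colouring {} c w" for c :: "'v set \<Rightarrow> 'd" and w by (simp add: concave_colouring_def)
  moreover have "\<exists>e\<in>E' - {}. \<exists>v\<in>e. \<forall>e'\<in>E'. v \<in> e' \<longrightarrow> e' = e" if "{} \<subset> E'" "E' \<subseteq> E" for E'
  proof -
    have "cycles E' = {}" using f cycles_mono[OF that(2)] unfolding forest_def by blast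
    then have "\<not> leafless E'" using leafless_has_cycle[of E'] simple_graph_subset[OF g that(2)] that by blast
    then show ?thesis unfolding leafless_def by blast
  qed
  ultimately show ?thesis using concave_colouring_peel[OF g, of "{}"] deg by blast
next
  assume "unicyclic E"
  then obtain C where C: "cycles E = {C}" unfolding unicyclic_def by blast
  have "\<exists>e\<in>E' - C. \<exists>v\<in>e. \<forall>e'\<in>E'. v \<in> e' \<longrightarrow> e' = e" if "C \<subset> E'" "E' \<subseteq> E" for E'
  proof -
    have "C \<in> cycles E" using C by simp
    then have "C \<in> cycles E'" using that(1) unfolding cycles_def by auto
    then have C': "cycles E' = {C}" using C cycles_mono[OF that(2)] by auto
    then have "\<not> leafless E'"
      using leafless_unicyclic_is_cycle[of E'] simple_graph_subset[OF g that(2)] that by blast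
    then obtain e v where ev: "e \<in> E'" "v \<in> e" "\<forall>e'\<in>E'. v \<in> e' \<longrightarrow> e' = e"
      unfolding leafless_def by blast
    moreover have "e \<notin> C" using cycle_vertex_two_edges[of C E' e v] ev(2,3) C' that(1) by auto
    ultimately show ?thesis by blast
  qed
  moreover obtain c :: "'v set \<Rightarrow> 'd" and w where "concave_colouring C c w"
    using concave_colouring_cycle[of C E] C d by blast
  moreover have "C \<subseteq> E" using C cycle_edges_subset[of C E] by simp
  ultimately show ?thesis using concave_colouring_peel[OF g, of C] deg by blast
qed

section \<open>Ideals, linear extension and substitution\<close>

abbreviation lookup where "lookup \<equiv> Poly_Mapping.lookup"
abbreviation keys where "keys \<equiv> Poly_Mapping.keys"
abbreviation single where "single \<equiv> Poly_Mapping.single"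

abbreviation const :: "'k::field \<Rightarrow> ('x, 'k) mpoly" where
  "const c \<equiv> Poly_Mapping.single 0 c"

lemma const_mult: "const (a * b) = const a * const b"
  by (simp add: mult_single)

lemma ideal_module: "module ((*) :: 'a::comm_ring_1 \<Rightarrow> 'a \<Rightarrow> 'a)"
  by unfold_locales (simp_all add: algebra_simps)

lemma ideal_gen_base: "a \<in> A \<Longrightarrow> a \<in> ideal_gen A"
  unfolding ideal_gen_def by (rule module.span_base[OF ideal_module])

lemma ideal_gen_zero: "0 \<in> ideal_gen A"
  unfolding ideal_gen_def by (rule module.span_zero[OF ideal_module])

lemma ideal_gen_add: "a \<in> ideal_gen A \<Longrightarrow> b \<in> ideal_gen A \<Longrightarrow> a + b \<in> ideal_gen A"
  unfolding ideal_gen_def by (rule module.span_add[OF ideal_module])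

lemma ideal_gen_mult: "a \<in> ideal_gen A \<Longrightarrow> c * a \<in> ideal_gen A"
  unfolding ideal_gen_def by (rule module.span_scale[OF ideal_module])

lemma ideal_gen_induct [consumes 1, case_names zero step]:
  assumes "x \<in> ideal_gen A" "P 0" "\<And>c a p. a \<in> A \<Longrightarrow> P p \<Longrightarrow> P (c * a + p)"
  shows "P x"
  using module.span_induct_alt[OF ideal_module, of x A P] assms
  unfolding ideal_gen_def by blast

lemma ideal_power_ideal:
  assumes "p \<in> ideal_power I s"
  shows "c * p \<in> ideal_power I s"
  using assms by (cases s) (auto intro: ideal_gen_mult)

lemma ideal_power_add:
  assumes "p \<in> ideal_power I s" "q \<in> ideal_power I s"
  shows "p + q \<in> ideal_power I s"
  using assms by (cases s) (auto intro: ideal_gen_add)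

lemma ideal_power_zero: "0 \<in> ideal_power I s"
  by (cases s) (auto intro: ideal_gen_zero)

definition is_ideal :: "'a::comm_ring_1 set \<Rightarrow> bool" where
  "is_ideal I \<longleftrightarrow> 0 \<in> I \<and> (\<forall>p\<in>I. \<forall>q\<in>I. p + q \<in> I) \<and> (\<forall>c. \<forall>p\<in>I. c * p \<in> I)"

lemma is_ideal_minus: "is_ideal I \<Longrightarrow> p \<in> I \<Longrightarrow> - p \<in> I"
  unfolding is_ideal_def by (metis mult_minus1)

lemma is_ideal_diff: "is_ideal I \<Longrightarrow> p \<in> I \<Longrightarrow> q \<in> I \<Longrightarrow> p - q \<in> I"
  using is_ideal_minus[of I q] unfolding is_ideal_def by (metis diff_conv_add_uminus)

lemma is_ideal_sum: "is_ideal I \<Longrightarrow> (\<And>i. i \<in> A \<Longrightarrow> f i \<in> I) \<Longrightarrow> (\<Sum>i\<in>A. f i) \<in> I"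
  by (induction A rule: infinite_finite_induct) (auto simp: is_ideal_def)

lemma is_ideal_mult_right: "is_ideal I \<Longrightarrow> p \<in> I \<Longrightarrow> p * c \<in> I"
  unfolding is_ideal_def by (metis mult.commute)

lemma is_ideal_mult_left: "is_ideal I \<Longrightarrow> p \<in> I \<Longrightarrow> c * p \<in> I"
  unfolding is_ideal_def by blast

lemma sum_single_lookup:
  assumes "finite X" "keys p \<subseteq> X"
  shows "(\<Sum>m\<in>X. single m (lookup p m)) = p"
proof (rule poly_mapping_eqI)
  fix k
  have "lookup (\<Sum>m\<in>X. single m (lookup p m)) k = (\<Sum>m\<in>X. if m = k then lookup p m else 0)"
    by (simp add: lookup_sum lookup_single when_def)
  also have "\<dots> = lookup p k"
    using assms by (auto simp: sum.delta not_in_keys_iff_lookup_eq_zero)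
  finally show "lookup (\<Sum>m\<in>X. single m (lookup p m)) k = lookup p k" .
qed

lemma monomial_induct [case_names zero add]:
  fixes m :: "'x::finite \<Rightarrow>\<^sub>0 nat"
  assumes "P 0" "\<And>m x. P m \<Longrightarrow> P (m + single x 1)"
  shows "P m"
proof (induction "\<Sum>x\<in>UNIV. lookup m x" arbitrary: m)
  case 0
  then have "m = 0" by (intro poly_mapping_eqI) auto
  then show ?case using assms(1) by simp
next
  case (Suc n)
  then obtain x where x: "lookup m x \<noteq> 0" by (metis nat.distinct(1) sum.neutral)
  define m' where "m' = m - single x 1"
  have m: "m = m' + single x 1"
    using x by (intro poly_mapping_eqI)
      (auto simp: m'_def lookup_add lookup_minus lookup_single when_def)
  have "(\<Sum>y\<in>UNIV. lookup m y) = (\<Sum>y\<in>UNIV. lookup m' y) + (\<Sum>y\<in>UNIV. if x = y then 1 else 0)"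
    unfolding m by (simp add: lookup_add sum.distrib lookup_single when_def)
  then have "n = (\<Sum>y\<in>UNIV. lookup m' y)" using Suc(2) by simp
  then have "P m'" by (rule Suc(1))
  then show ?case using assms(2) m by simp
qed

lemma mpoly_induct [case_names const Var add mult]:
  fixes p :: "('x::finite, 'k::field) mpoly"
  assumes c: "\<And>c. P (const c)" and V: "\<And>x. P (Var x)"
    and a: "\<And>p q. P p \<Longrightarrow> P q \<Longrightarrow> P (p + q)" and m: "\<And>p q. P p \<Longrightarrow> P q \<Longrightarrow> P (p * q)"
  shows "P p"
proof -
  have s: "P (single n k)" for n k
  proof (induction n rule: monomial_induct)
    case zero
    then show ?case by (rule c)
  next
    case (add n x)
    have "single (n + single x 1) k = single n k * Var x"
      by (simp add: Var_def mult_single)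
    then show ?case using m[OF add V] by simp
  qed
  have "P (\<Sum>n\<in>X. single n (lookup p n))" if "finite X" for X
    using that
  proof induction
    case empty
    then show ?case using c[of 0] by simp
  next
    case (insert n X)
    then show ?case using a s by simp
  qed
  from this[of "keys p"] show ?thesis by (simp add: sum_single_lookup)
qed

text \<open>
  The \<open>k\<close>-linear map given on the basis by \<open>g\<close>. With monomials as the basis and a product of values as
  \<open>g\<close> it is substitution; with another family \<open>g\<close> it describes the span of that family.
\<close>
definition lin_ext :: "('m \<Rightarrow> ('x, 'k::field) mpoly) \<Rightarrow> ('m \<Rightarrow>\<^sub>0 'k) \<Rightarrow> ('x, 'k) mpoly" where
  "lin_ext g c = (\<Sum>m\<in>keys c. const (lookup c m) * g m)"

lemma lin_ext_superset:
  assumes "finite X" "keys c \<subseteq> X"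
  shows "lin_ext g c = (\<Sum>m\<in>X. const (lookup c m) * g m)"
  unfolding lin_ext_def using assms
  by (intro sum.mono_neutral_left) (auto simp: in_keys_iff)

lemma lin_ext_add: "lin_ext g (c + d) = lin_ext g c + lin_ext g d"
proof -
  let ?X = "keys c \<union> keys d"
  have "lin_ext g (c + d) = (\<Sum>m\<in>?X. const (lookup (c + d) m) * g m)"
    using keys_add[of c d] by (intro lin_ext_superset) auto
  also have "\<dots> = lin_ext g c + lin_ext g d"
    by (simp add: lin_ext_superset[of ?X] lookup_add single_add distrib_right sum.distrib)
  finally show ?thesis .
qed

lemma lin_ext_zero [simp]: "lin_ext g 0 = 0"
  by (simp add: lin_ext_def)

lemma lin_ext_single: "lin_ext g (single m k) = const k * g m"
  by (subst lin_ext_superset[of "{m}"]) auto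

lemma lin_ext_sum: "lin_ext g (\<Sum>i\<in>A. f i) = (\<Sum>i\<in>A. lin_ext g (f i))"
  by (induction A rule: infinite_finite_induct) (auto simp: lin_ext_add)

definition subst :: "('x \<Rightarrow> ('y, 'k) mpoly) \<Rightarrow> ('x::finite, 'k::field) mpoly \<Rightarrow> ('y, 'k) mpoly" where
  "subst t = lin_ext (\<lambda>m. \<Prod>x\<in>UNIV. t x ^ lookup m x)"

lemma subst_add: "subst t (p + q) = subst t p + subst t q"
  by (simp add: subst_def lin_ext_add)

lemma subst_zero [simp]: "subst t 0 = 0"
  by (simp add: subst_def)

lemma subst_sum: "subst t (\<Sum>i\<in>A. f i) = (\<Sum>i\<in>A. subst t (f i))"
  by (simp add: subst_def lin_ext_sum)

lemma subst_const [simp]: "subst t (const k) = const k"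
  by (simp add: subst_def lin_ext_single)

lemma subst_one [simp]: "subst t 1 = 1"
  using subst_const[of t 1] by simp

lemma subst_single_mult:
  "subst t (single m a * single n b) = subst t (single m a) * subst t (single n b)"
proof -
  have "single m a * single n b = single (m + n) (a * b)" by (rule mult_single)
  then show ?thesis
    by (simp add: subst_def lin_ext_single lookup_add power_add prod.distrib const_mult ac_simps)
qed

lemma subst_mult: "subst t (p * q) = subst t p * subst t q"
proof -
  have e: "p * q = (\<Sum>m\<in>keys p. \<Sum>n\<in>keys q. single m (lookup p m) * single n (lookup q n))"
  proof -
    have "p * q = (\<Sum>m\<in>keys p. single m (lookup p m)) * (\<Sum>n\<in>keys q. single n (lookup q n))"
      by (simp add: sum_single_lookup)
    then show ?thesis by (simp add: sum_product)
  qed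
  have "subst t (p * q) = (\<Sum>m\<in>keys p. subst t (single m (lookup p m))) *
      (\<Sum>n\<in>keys q. subst t (single n (lookup q n)))"
    unfolding e by (simp add: subst_sum subst_single_mult sum_product)
  also have "\<dots> = subst t p * subst t q"
    unfolding subst_sum[symmetric] by (simp add: sum_single_lookup)
  finally show ?thesis .
qed

lemma subst_power: "subst t (p ^ n) = subst t p ^ n"
  by (induction n) (auto simp: subst_mult)

lemma subst_prod: "subst t (\<Prod>i\<in>A. f i) = (\<Prod>i\<in>A. subst t (f i))"
  by (induction A rule: infinite_finite_induct) (auto simp: subst_mult)

lemma subst_Var [simp]: "subst t (Var x) = t x"
proof -
  have "(\<Prod>y\<in>UNIV. t y ^ lookup (single x (1::nat)) y) = (\<Prod>y\<in>UNIV. if y = x then t y else 1)"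
    by (intro prod.cong) (auto simp: lookup_single when_def)
  also have "\<dots> = t x" by simp
  finally show ?thesis by (simp add: subst_def Var_def lin_ext_single)
qed

lemma subst_diff: "subst t (p - q) = subst t p - subst t q"
  using subst_add[of t "p - q" q] by (simp add: algebra_simps)

lemma subst_single: "subst t (single m k) = const k * (\<Prod>x\<in>UNIV. t x ^ lookup m x)"
  by (simp add: subst_def lin_ext_single)

lemma subst_in_ideal:
  assumes I: "is_ideal I" and p: "\<And>m. m \<in> keys p \<Longrightarrow> \<exists>x. lookup m x \<noteq> 0 \<and> t x \<in> I"
  shows "subst t p \<in> I"
proof -
  have "subst t (single m (lookup p m)) \<in> I" if m: "m \<in> keys p" for m
  proof -
    obtain x where x: "lookup m x \<noteq> 0" "t x \<in> I" using p[OF m] by blast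
    obtain n where n: "lookup m x = Suc n" using x(1) not0_implies_Suc by blast
    have "(\<Prod>y\<in>UNIV. t y ^ lookup m y) = t x ^ lookup m x * (\<Prod>y\<in>UNIV - {x}. t y ^ lookup m y)"
      by (intro prod.remove) auto
    then have "(\<Prod>y\<in>UNIV. t y ^ lookup m y) = t x * (t x ^ n * (\<Prod>y\<in>UNIV - {x}. t y ^ lookup m y))"
      by (simp add: n mult.assoc)
    then show ?thesis
      using x(2) by (simp add: subst_single is_ideal_mult_left[OF I] is_ideal_mult_right[OF I])
  qed
  then have "(\<Sum>m\<in>keys p. subst t (single m (lookup p m))) \<in> I" by (intro is_ideal_sum[OF I])
  then show ?thesis by (simp add: subst_sum[symmetric] sum_single_lookup)
qed

lemma power_in_ideal_power: "f \<in> I \<Longrightarrow> f ^ n \<in> ideal_power I n"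
proof (induction n)
  case (Suc n)
  then have "f * f ^ n \<in> {a * b |a b. a \<in> I \<and> b \<in> ideal_power I n}" by blast
  then show ?case using ideal_gen_base by (simp add: ideal_gen_base)
qed simp

lemma subst_ideal_gen:
  assumes "\<And>a. a \<in> A \<Longrightarrow> subst t a \<in> ideal_gen B" "p \<in> ideal_gen A"
  shows "subst t p \<in> ideal_gen B"
  using assms(2)
proof (induction rule: ideal_gen_induct)
  case (step c a p)
  then show ?case using assms(1)[of a] by (simp add: subst_add subst_mult ideal_gen_add ideal_gen_mult)
qed (simp add: ideal_gen_zero)

lemma subst_ideal_power:
  assumes "\<And>a. a \<in> I \<Longrightarrow> subst t a \<in> K"
  shows "p \<in> ideal_power I s \<Longrightarrow> subst t p \<in> ideal_power K s"
proof (induction s arbitrary: p)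
  case (Suc s)
  show ?case unfolding ideal_power.simps
  proof (rule subst_ideal_gen)
    show "p \<in> ideal_gen {a * b |a b. a \<in> I \<and> b \<in> ideal_power I s}" using Suc.prems by simp
    fix x assume "x \<in> {a * b |a b. a \<in> I \<and> b \<in> ideal_power I s}"
    then obtain a b where "x = a * b" "a \<in> I" "b \<in> ideal_power I s" by blast
    then show "subst t x \<in> ideal_gen {a * b |a b. a \<in> K \<and> b \<in> ideal_power K s}"
      using assms Suc.IH by (intro ideal_gen_base) (auto simp: subst_mult)
  qed
qed simp

lemma is_ideal_ideal_power: "is_ideal (ideal_power I s)"
  unfolding is_ideal_def by (auto intro: ideal_power_zero ideal_power_add ideal_power_ideal)

lemma lookup_const_mult:
  fixes q :: "('x, 'k::field) mpoly"
  shows "lookup (const a * q) m = a * lookup q m"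
  by (simp add: mult_map_scale_conv_mult[symmetric] Poly_Mapping.map.rep_eq when_def)

section \<open>Powers of ideals generated by triangular quadrics\<close>

definition weight :: "('x::finite \<Rightarrow> nat) \<Rightarrow> ('x \<Rightarrow>\<^sub>0 nat) \<Rightarrow> nat" where
  "weight w m = (\<Sum>x\<in>UNIV. w x * lookup m x)"

lemma weight_add: "weight w (m + n) = weight w m + weight w n"
  by (simp add: weight_def lookup_add distrib_left sum.distrib)

lemma weight_single: "weight w (single x k) = w x * k"
proof -
  have "weight w (single x k) = (\<Sum>y\<in>UNIV. if y = x then w x * k else 0)"
    unfolding weight_def by (intro sum.cong) (auto simp: lookup_single when_def)
  then show ?thesis by simp
qed

text \<open>
  Only a comparison by weight, not a monomial order: all other monomials of \<open>p\<close> are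
  strictly lighter than \<open>m\<close>, and \<open>m\<close> has coefficient 1.
\<close>
definition lead :: "('x::finite \<Rightarrow> nat) \<Rightarrow> ('x \<Rightarrow>\<^sub>0 nat) \<Rightarrow> ('x, 'k::field) mpoly \<Rightarrow> bool" where
  "lead w m p \<longleftrightarrow> (\<forall>n\<in>keys (p - single m 1). weight w n < weight w m)"

lemma lead_lookup: "lead w m p \<Longrightarrow> lookup p m = 1"
  unfolding lead_def using lookup_minus[of p "single m 1" m]
  by (metis eq_iff_diff_eq_0 in_keys_iff less_irrefl lookup_single_eq)

lemma lead_keys:
  assumes "lead w m p" "n \<in> keys p"
  shows "n = m \<or> weight w n < weight w m"
  using assms unfolding lead_def
  by (metis in_keys_iff lookup_minus lookup_single_not_eq diff_zero)

lemma lead_single: "lead w m (single m 1)"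
  by (simp add: lead_def)

lemma lead_mult:
  assumes "lead w m p" "lead w n q"
  shows "lead w (m + n) (p * q)"
  unfolding lead_def
proof
  fix k assume k: "k \<in> keys (p * q - single (m + n) 1)"
  have "p * q - single (m + n) 1 = (p - single m 1) * q + single m 1 * (q - single n 1)"
    by (simp add: algebra_simps mult_single)
  then have "k \<in> keys ((p - single m 1) * q) \<union> keys (single m 1 * (q - single n 1))"
    using k keys_add by fastforce
  then consider a b where "k = a + b" "a \<in> keys (p - single m 1)" "b \<in> keys q"
    | a b where "k = a + b" "a \<in> keys (single m (1::'b))" "b \<in> keys (q - single n 1)"
    using keys_mult by blast
  then show "weight w k < weight w (m + n)"
  proof cases
    case 1
    then have "weight w a < weight w m" "weight w b \<le> weight w n"
      using assms lead_keys[OF assms(2)] unfolding lead_def by force+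
    then show ?thesis using 1 by (simp add: weight_add)
  next
    case 2
    then have "weight w b < weight w n" "a = m" using assms unfolding lead_def by auto
    then show ?thesis using 2 by (simp add: weight_add)
  qed
qed

lemma lead_one: "lead w 0 1"
  using lead_single[of w 0] by simp

lemma lead_power_single:
  assumes "lead w (single x k) p"
  shows "lead w (single x (n * k)) (p ^ n)"
proof (induction n)
  case 0
  then show ?case by (simp add: lead_one)
next
  case (Suc n)
  then show ?case using lead_mult[OF assms Suc] by (simp add: single_add[symmetric])
qed

lemma lead_prod:
  assumes "finite X" "\<And>x. x \<in> X \<Longrightarrow> lead w (m x) (p x)"
  shows "lead w (\<Sum>x\<in>X. m x) (\<Prod>x\<in>X. p x)"
  using assms by (induction X) (auto simp: lead_one lead_mult)

lemma Var_power: "Var x ^ n = single (single x n) 1"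
  by (induction n) (auto simp: Var_def mult_single single_add[symmetric])

text \<open>
  Deformations of the squares of the variables: the remaining terms are products of two variables,
  and each product is lighter than the square.
\<close>
locale triangular_quadrics =
  fixes w :: "'x::finite \<Rightarrow> nat" and T :: "'x \<Rightarrow> 't set" and \<alpha> \<beta> :: "'x \<Rightarrow> 't \<Rightarrow> 'x"
    and F :: "'x \<Rightarrow> ('x, 'k::field) mpoly"
  assumes F_eq: "\<And>x. F x = Var x ^ 2 + (\<Sum>t\<in>T x. Var (\<alpha> x t) * Var (\<beta> x t))"
    and lower: "\<And>x t. t \<in> T x \<Longrightarrow> w (\<alpha> x t) + w (\<beta> x t) < 2 * w x"
begin

text \<open>
  Monomials with each square \<open>Var x ^ 2\<close> replaced by \<open>F x\<close>. The leading monomials of these elements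
  are pairwise distinct, so they are linearly independent.
\<close>
definition base :: "('x \<Rightarrow>\<^sub>0 nat) \<Rightarrow> ('x, 'k) mpoly" where
  "base m = (\<Prod>x\<in>UNIV. Var x ^ (lookup m x mod 2) * F x ^ (lookup m x div 2))"

text \<open>The number of factors \<open>F x\<close> in \<open>base m\<close>.\<close>
definition half_degree :: "('x \<Rightarrow>\<^sub>0 nat) \<Rightarrow> nat" where
  "half_degree m = (\<Sum>x\<in>UNIV. lookup m x div 2)"

lemma lead_F: "lead w (single x 2) (F x)"
  unfolding lead_def
proof
  fix n assume n: "n \<in> keys (F x - single (single x 2) 1)"
  have "F x - single (single x 2) 1 = (\<Sum>t\<in>T x. Var (\<alpha> x t) * Var (\<beta> x t))"
    by (simp add: F_eq Var_power)
  then have "n \<in> (\<Union>t\<in>T x. keys (Var (\<alpha> x t) * Var (\<beta> x t) :: ('x, 'k) mpoly))"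
    using n keys_sum by fastforce
  then obtain t where "t \<in> T x" "n = single (\<alpha> x t) 1 + single (\<beta> x t) 1"
    by (auto simp: Var_def mult_single)
  then show "weight w n < weight w (single x 2)"
    using lower[of t x] by (simp add: weight_add weight_single)
qed

lemma lead_base: "lead w m (base m)"
proof -
  have "lead w (single x (lookup m x)) (Var x ^ (lookup m x mod 2) * F x ^ (lookup m x div 2))" for x
  proof -
    have "lead w (single x (lookup m x mod 2) + single x (lookup m x div 2 * 2))
        (Var x ^ (lookup m x mod 2) * F x ^ (lookup m x div 2))"
      by (intro lead_mult lead_power_single lead_F) (simp add: Var_power lead_single)
    moreover have "lookup m x mod 2 + lookup m x div 2 * 2 = lookup m x" by simp
    ultimately show ?thesis by (simp only: single_add[symmetric])
  qed
  then have "lead w (\<Sum>x\<in>UNIV. single x (lookup m x)) (base m)"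
    unfolding base_def by (intro lead_prod) auto
  then show ?thesis by (simp add: sum_single_lookup)
qed

definition base_span :: "(('x \<Rightarrow>\<^sub>0 nat) \<Rightarrow> bool) \<Rightarrow> ('x, 'k) mpoly set" where
  "base_span P = lin_ext base ` {c. \<forall>m\<in>keys c. P m}"

lemma base_span_add:
  assumes "p \<in> base_span P" "q \<in> base_span P"
  shows "p + q \<in> base_span P"
proof -
  obtain c d where cd: "p = lin_ext base c" "q = lin_ext base d"
      "\<forall>m\<in>keys c. P m" "\<forall>m\<in>keys d. P m"
    using assms unfolding base_span_def by blast
  have "p + q = lin_ext base (c + d)" by (simp add: lin_ext_add cd)
  moreover have "\<forall>m\<in>keys (c + d). P m" using cd(3,4) keys_add[of c d] by blast
  ultimately show ?thesis unfolding base_span_def by blast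
qed

lemma base_span_term: "P m \<Longrightarrow> const k * base m \<in> base_span P"
  unfolding base_span_def using lin_ext_single[of base m k]
  by (intro image_eqI[of _ _ "single m k"]) auto

lemma base_span_base: "P m \<Longrightarrow> base m \<in> base_span P"
  using base_span_term[of P m 1] by simp

lemma base_span_zero: "0 \<in> base_span P"
  unfolding base_span_def by (intro image_eqI[of _ _ 0]) auto

lemma base_span_sum: "(\<And>i. i \<in> A \<Longrightarrow> f i \<in> base_span P) \<Longrightarrow> (\<Sum>i\<in>A. f i) \<in> base_span P"
  by (induction A rule: infinite_finite_induct) (auto intro: base_span_add base_span_zero)

lemma base_span_mult_left:
  assumes p: "p \<in> base_span P" and b: "\<And>m. P m \<Longrightarrow> q * base m \<in> base_span Q"
    and c: "\<And>k r. r \<in> base_span Q \<Longrightarrow> const k * r \<in> base_span Q"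
  shows "q * p \<in> base_span Q"
proof -
  obtain d where d: "p = lin_ext base d" "\<forall>m\<in>keys d. P m"
    using p unfolding base_span_def by blast
  have "q * p = (\<Sum>m\<in>keys d. const (lookup d m) * (q * base m))"
    by (simp add: d(1) lin_ext_def sum_distrib_left ac_simps)
  also have "\<dots> \<in> base_span Q" using d(2) b c by (intro base_span_sum) auto
  finally show ?thesis .
qed

lemma base_span_scale:
  assumes "p \<in> base_span P"
  shows "const k * p \<in> base_span P"
proof -
  obtain d where d: "p = lin_ext base d" "\<forall>m\<in>keys d. P m"
    using assms unfolding base_span_def by blast
  have "const k * p = (\<Sum>m\<in>keys d. const (k * lookup d m) * base m)"
  proof -
    have "const k * (const (lookup d m) * base m) = const (k * lookup d m) * base m" for m
      by (simp add: mult.assoc[symmetric] mult_single)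
    then show ?thesis by (simp add: d(1) lin_ext_def sum_distrib_left)
  qed
  also have "\<dots> \<in> base_span P" using d(2) by (intro base_span_sum base_span_term) auto
  finally show ?thesis .
qed

lemma base_span_mono: "p \<in> base_span P \<Longrightarrow> (\<And>m. P m \<Longrightarrow> Q m) \<Longrightarrow> p \<in> base_span Q"
  unfolding base_span_def by blast

lemma base_add_even:
  assumes "even (lookup m c)"
  shows "base (m + single c 1) = Var c * base m"
proof -
  let ?g = "\<lambda>m x. Var x ^ (lookup m x mod 2) * F x ^ (lookup m x div 2)"
  have "base (m + single c 1) = ?g (m + single c 1) c * (\<Prod>x\<in>UNIV - {c}. ?g (m + single c 1) x)"
    unfolding base_def by (rule prod.remove) auto
  also have "(\<Prod>x\<in>UNIV - {c}. ?g (m + single c 1) x) = (\<Prod>x\<in>UNIV - {c}. ?g m x)"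
    by (intro prod.cong) (auto simp: lookup_add lookup_single when_def)
  also have "?g (m + single c 1) c = Var c * ?g m c"
    using assms by (auto simp: lookup_add elim: evenE)
  finally show ?thesis
    unfolding base_def by (subst (2) prod.remove[of _ c]) (auto simp: mult.assoc)
qed

lemma base_add_two: "base (m + single c 2) = F c * base m"
proof -
  let ?g = "\<lambda>m x. Var x ^ (lookup m x mod 2) * F x ^ (lookup m x div 2)"
  have "base (m + single c 2) = ?g (m + single c 2) c * (\<Prod>x\<in>UNIV - {c}. ?g (m + single c 2) x)"
    unfolding base_def by (rule prod.remove) auto
  also have "(\<Prod>x\<in>UNIV - {c}. ?g (m + single c 2) x) = (\<Prod>x\<in>UNIV - {c}. ?g m x)"
    by (intro prod.cong) (auto simp: lookup_add lookup_single when_def)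
  also have "?g (m + single c 2) c = F c * ?g m c"
    by (simp add: lookup_add)
  finally show ?thesis
    unfolding base_def by (subst (2) prod.remove[of _ c]) (auto simp: mult.assoc)
qed

lemma half_degree_add_two: "half_degree (m + single c 2) = Suc (half_degree m)"
proof -
  have "half_degree (m + single c 2) = (\<Sum>x\<in>UNIV. lookup m x div 2 + (if x = c then 1 else 0))"
    unfolding half_degree_def by (intro sum.cong) (auto simp: lookup_add lookup_single when_def)
  then show ?thesis by (simp add: sum.distrib half_degree_def)
qed

lemma half_degree_add_even:
  assumes "even (lookup m c)"
  shows "half_degree (m + single c 1) = half_degree m"
  unfolding half_degree_def using assms
  by (intro sum.cong) (auto simp: lookup_add lookup_single when_def)

text \<open>
  If \<open>Var c\<close> already occurs to an odd power, multiplication creates \<open>Var c ^ 2\<close>, which is \<open>F c\<close> minus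
  lighter products of two variables. The rewriting terminates because the weight goes down, and
  it never decreases the number of factors \<open>F x\<close>.
\<close>
lemma Var_mult_base:
  "Var c * base m \<in> base_span (\<lambda>n. half_degree m \<le> half_degree n \<and> weight w n \<le> w c + weight w m)"
proof (induction "w c + weight w m" arbitrary: c m rule: less_induct)
  case less
  let ?P = "\<lambda>n. half_degree m \<le> half_degree n \<and> weight w n \<le> w c + weight w m"
  show ?case
  proof (cases "even (lookup m c)")
    case True
    have "base (m + single c 1) \<in> base_span ?P"
      using half_degree_add_even[OF True] by (intro base_span_base) (simp add: weight_add weight_single)
    then show ?thesis using base_add_even[OF True] by simp
  next
    case False
    define m' where "m' = m - single c 1"
    have m: "m = m' + single c 1" using False
      by (intro poly_mapping_eqI) (auto simp: m'_def lookup_add lookup_minus lookup_single when_def elim: oddE)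
    have ev: "even (lookup m' c)" using False by (simp add: m lookup_add)
    have ord: "half_degree m = half_degree m'" using half_degree_add_even[OF ev] m by simp
    have wt: "weight w m = weight w m' + w c" by (simp add: m weight_add weight_single)
    have "Var c * base m = Var c ^ 2 * base m'"
      using base_add_even[OF ev] m by (simp add: power2_eq_square mult.assoc)
    also have "Var c ^ 2 = F c + const (-1) * (\<Sum>t\<in>T c. Var (\<alpha> c t) * Var (\<beta> c t))"
      by (simp add: F_eq single_uminus)
    also have "\<dots> * base m' = base (m' + single c 2) +
        const (-1) * (\<Sum>t\<in>T c. Var (\<alpha> c t) * (Var (\<beta> c t) * base m'))"
      by (simp add: base_add_two distrib_right sum_distrib_right mult.assoc)
    also have "\<dots> \<in> base_span ?P"
    proof (intro base_span_add base_span_scale base_span_sum)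
      show "base (m' + single c 2) \<in> base_span ?P"
        using half_degree_add_two[of m' c] ord wt by (intro base_span_base) (simp add: weight_add weight_single)
    next
      fix t assume t: "t \<in> T c"
      have l: "w (\<alpha> c t) + w (\<beta> c t) < 2 * w c" by (rule lower[OF t])
      have "Var (\<beta> c t) * base m' \<in>
          base_span (\<lambda>n. half_degree m' \<le> half_degree n \<and> weight w n \<le> w (\<beta> c t) + weight w m')"
        using l wt by (intro less) linarith
      then show "Var (\<alpha> c t) * (Var (\<beta> c t) * base m') \<in> base_span ?P"
      proof (rule base_span_mult_left)
        fix n assume n: "half_degree m' \<le> half_degree n \<and> weight w n \<le> w (\<beta> c t) + weight w m'"
        have "Var (\<alpha> c t) * base n \<in>
            base_span (\<lambda>k. half_degree n \<le> half_degree k \<and> weight w k \<le> w (\<alpha> c t) + weight w n)"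
          using l wt n by (intro less) linarith
        then show "Var (\<alpha> c t) * base n \<in> base_span ?P"
          by (rule base_span_mono) (use l wt n ord in linarith)
      qed (rule base_span_scale)
    qed
    finally show ?thesis .
  qed
qed

lemma base_span_ideal:
  assumes "p \<in> base_span (\<lambda>m. s \<le> half_degree m)"
  shows "q * p \<in> base_span (\<lambda>m. s \<le> half_degree m)"
  using assms
proof (induction q arbitrary: p rule: mpoly_induct)
  case (const c)
  then show ?case by (rule base_span_scale)
next
  case (Var x)
  then show ?case
  proof (rule base_span_mult_left)
    fix m assume "s \<le> half_degree m"
    then show "Var x * base m \<in> base_span (\<lambda>m. s \<le> half_degree m)"
      using base_span_mono[OF Var_mult_base[of x m]] by auto
  qed (rule base_span_scale)
next
  case (add q r)
  then show ?case by (simp add: distrib_right base_span_add)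
next
  case (mult q r)
  then show ?case by (simp add: mult.assoc)
qed

text \<open>
  The elements \<open>base m\<close> with at least \<open>s\<close> factors \<open>F x\<close> form a basis of the \<open>s\<close>-th power of the
  ideal; this is the half that says that they span it. It holds because their span is an ideal and
  multiplication by \<open>F x\<close> adds a factor.
\<close>
lemma ideal_power_in_base_span:
  "p \<in> ideal_power (ideal_gen (range F)) s \<Longrightarrow> p \<in> base_span (\<lambda>m. s \<le> half_degree m)"
proof (induction s arbitrary: p)
  case 0
  have "base 0 = 1" by (simp add: base_def)
  then have "1 \<in> base_span (\<lambda>m. 0 \<le> half_degree m)" using base_span_base[of _ 0] by simp
  from base_span_ideal[OF this, of p] show ?case by simp
next
  case (Suc s)
  have F: "F x * q \<in> base_span (\<lambda>m. Suc s \<le> half_degree m)" if "q \<in> base_span (\<lambda>m. s \<le> half_degree m)" for x q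
    using that
  proof (rule base_span_mult_left)
    fix m assume "s \<le> half_degree m"
    then have "base (m + single x 2) \<in> base_span (\<lambda>m. Suc s \<le> half_degree m)"
      by (intro base_span_base) (simp add: half_degree_add_two)
    then show "F x * base m \<in> base_span (\<lambda>m. Suc s \<le> half_degree m)" by (simp add: base_add_two)
  qed (rule base_span_scale)
  have I: "a * q \<in> base_span (\<lambda>m. Suc s \<le> half_degree m)"
    if "a \<in> ideal_gen (range F)" "q \<in> base_span (\<lambda>m. s \<le> half_degree m)" for a q
    using that(1)
  proof (induction rule: ideal_gen_induct)
    case zero
    then show ?case by (simp add: base_span_zero)
  next
    case (step c a p)
    then have "c * (a * q) \<in> base_span (\<lambda>m. Suc s \<le> half_degree m)"
      using F[OF that(2)] base_span_ideal by blast
    then show ?case using step by (simp add: distrib_right mult.assoc base_span_add)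
  qed
  show ?case using Suc(2) unfolding ideal_power.simps
  proof (induction rule: ideal_gen_induct)
    case zero
    then show ?case by (rule base_span_zero)
  next
    case (step c a p)
    then obtain a1 a2 where "a = a1 * a2" "a1 \<in> ideal_gen (range F)"
      "a2 \<in> base_span (\<lambda>m. s \<le> half_degree m)" using Suc(1) by blast
    then have "a \<in> base_span (\<lambda>m. Suc s \<le> half_degree m)" using I by simp
    then show ?case using step base_span_add base_span_ideal by blast
  qed
qed

text \<open>
  In a linear combination of the \<open>base m\<close>, a monomial \<open>m\<close> of maximal weight among the indices
  occurs in no other summand and so cannot cancel.
\<close>
lemma base_span_leading:
  assumes "p \<in> base_span P" "p \<noteq> 0"
  shows "\<exists>m. P m \<and> m \<in> keys p \<and> (\<forall>n\<in>keys p. weight w n \<le> weight w m)"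
proof -
  obtain d where d: "p = lin_ext base d" "\<forall>m\<in>keys d. P m"
    using assms unfolding base_span_def by blast
  have "keys d \<noteq> {}" using assms(2) d(1) by (auto simp: lin_ext_def)
  then have "Max (weight w ` keys d) \<in> weight w ` keys d" by (intro Max_in) auto
  then obtain m where "m \<in> keys d" "weight w m = Max (weight w ` keys d)" by force
  then have m: "m \<in> keys d" "\<And>n. n \<in> keys d \<Longrightarrow> weight w n \<le> weight w m" by simp_all
  have look: "lookup p k = (\<Sum>n\<in>keys d. lookup d n * lookup (base n) k)" for k
    by (simp add: d(1) lin_ext_def lookup_sum lookup_const_mult)
  have "lookup (base n) m = (if n = m then 1 else 0)" if "n \<in> keys d" for n
  proof (cases "n = m")
    case True
    then show ?thesis using lead_lookup[OF lead_base] by simp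
  next
    case False
    then have "m \<notin> keys (base n)" using lead_keys[OF lead_base, of m n] m(2)[OF that] by force
    then show ?thesis using False by (simp add: in_keys_iff)
  qed
  then have "lookup p m = (\<Sum>n\<in>keys d. if n = m then lookup d n else 0)"
    unfolding look by (intro sum.cong) auto
  then have "lookup p m = lookup d m" using m(1) by simp
  then have "m \<in> keys p" using m(1) by (simp add: in_keys_iff)
  moreover have "weight w k \<le> weight w m" if k: "k \<in> keys p" for k
  proof -
    have "(\<Sum>n\<in>keys d. lookup d n * lookup (base n) k) \<noteq> 0"
      using k look[of k] by (simp add: in_keys_iff)
    then obtain n where "n \<in> keys d" "lookup d n * lookup (base n) k \<noteq> 0"
      by (rule sum.not_neutral_contains_not_neutral)
    then have "n \<in> keys d" "k \<in> keys (base n)" by (auto simp: in_keys_iff)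
    then show ?thesis using lead_keys[OF lead_base, of k n] m(2)[of n] by force
  qed
  ultimately show ?thesis using d(2) m(1) by blast
qed

text \<open>
  The product is itself one of the basis elements, with \<open>n < s\<close> factors \<open>F x\<close>, so by comparison of
  leading monomials it is no combination of those with at least \<open>s\<close> factors.
\<close>
theorem squarefree_times_power_notin:
  assumes "finite A" "n < s"
  shows "(\<Prod>a\<in>A. Var a) * F x ^ n \<notin> ideal_power (ideal_gen (range F)) s"
proof
  define mA :: "'x \<Rightarrow>\<^sub>0 nat" where "mA = (\<Sum>a\<in>A. single a 1)"
  define m where "m = mA + single x (2 * n)"
  have lA: "lookup mA y = (if y \<in> A then 1 else 0)" for y
    using assms(1) by (simp add: mA_def lookup_sum lookup_single when_def)
  have "base mA = (\<Prod>y\<in>UNIV. if y \<in> A then Var y else 1)"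
    unfolding base_def by (intro prod.cong) (auto simp: lA)
  also have "\<dots> = (\<Prod>a\<in>A. Var a)" by (simp add: prod.If_cases)
  finally have bA: "base mA = (\<Prod>a\<in>A. Var a)" .
  have oA: "half_degree mA = 0" by (simp add: half_degree_def lA)
  have "base (mA + single x (2 * k)) = (\<Prod>a\<in>A. Var a) * F x ^ k \<and>
      half_degree (mA + single x (2 * k)) = k" for k
  proof (induction k)
    case 0
    then show ?case by (simp add: bA oA)
  next
    case (Suc k)
    have "single x (2 * Suc k) = single x (2 * k) + single x 2" by (simp add: single_add[symmetric])
    then have "mA + single x (2 * Suc k) =
        (mA + single x (2 * k)) + single x 2" by (simp only: add.assoc)
    then show ?case
      using Suc by (simp only: base_add_two half_degree_add_two) (simp add: ac_simps)
  qed
  then have b: "base m = (\<Prod>a\<in>A. Var a) * F x ^ n" and o: "half_degree m = n" unfolding m_def by auto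
  assume "(\<Prod>a\<in>A. Var a) * F x ^ n \<in> ideal_power (ideal_gen (range F)) s"
  then have "base m \<in> base_span (\<lambda>m. s \<le> half_degree m)" using ideal_power_in_base_span b by simp
  moreover have "base m \<noteq> 0" using lead_lookup[OF lead_base, of m] by auto
  ultimately obtain k where k: "s \<le> half_degree k" "k \<in> keys (base m)"
      "\<forall>n\<in>keys (base m). weight w n \<le> weight w k"
    using base_span_leading by blast
  have "m \<in> keys (base m)" using lead_lookup[OF lead_base, of m] by (simp add: in_keys_iff)
  then have "weight w m \<le> weight w k" using k(3) by blast
  then have "k = m" using lead_keys[OF lead_base k(2)] by simp
  then show False using k(1) o assms(2) by simp
qed

end

section \<open>Homogeneous components and graded free resolutions\<close>

lemma mon_degree_eq:
  fixes m :: "'x::finite \<Rightarrow>\<^sub>0 nat"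
  shows "mon_degree m = (\<Sum>x\<in>UNIV. lookup m x)"
  unfolding mon_degree_def by (intro sum.mono_neutral_left) (auto simp: in_keys_iff)

lemma mon_degree_add:
  fixes m n :: "'x::finite \<Rightarrow>\<^sub>0 nat"
  shows "mon_degree (m + n) = mon_degree m + mon_degree n"
  by (simp add: mon_degree_eq lookup_add sum.distrib)

lemma homogeneous_mult:
  fixes p q :: "('x::finite, 'k::field) mpoly"
  assumes "homogeneous i p" "homogeneous j q"
  shows "homogeneous (i + j) (p * q)"
  unfolding homogeneous_def
proof
  fix m assume "m \<in> keys (p * q)"
  then obtain a b where "m = a + b" "a \<in> keys p" "b \<in> keys q" using keys_mult by blast
  then show "int (mon_degree m) = i + j"
    using assms by (simp add: homogeneous_def mon_degree_add)
qed

lemma homogeneous_zero [simp]: "homogeneous d 0"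
  by (simp add: homogeneous_def)

lemma homogeneous_add: "homogeneous d p \<Longrightarrow> homogeneous d q \<Longrightarrow> homogeneous d (p + q)"
  unfolding homogeneous_def using keys_add[of p q] by blast

lemma homogeneous_sum: "(\<And>i. i \<in> A \<Longrightarrow> homogeneous d (f i)) \<Longrightarrow> homogeneous d (\<Sum>i\<in>A. f i)"
  by (induction A rule: infinite_finite_induct) (auto intro: homogeneous_add)

lemma homogeneous_const: "homogeneous 0 (const c)"
  by (simp add: homogeneous_def mon_degree_def)

lemma homogeneous_one: "homogeneous 0 (1 :: ('x, 'k::field) mpoly)"
  using homogeneous_const[of 1] by simp

lemma homogeneous_Var: "homogeneous 1 (Var x)"
  by (simp add: homogeneous_def Var_def mon_degree_def)

definition degree_part :: "int \<Rightarrow> ('x, 'k::field) mpoly \<Rightarrow> ('x, 'k) mpoly" where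
  "degree_part d p = Poly_Mapping.mapp (\<lambda>m c. if int (mon_degree m) = d then c else 0) p"

lemma lookup_degree_part: "lookup (degree_part d p) m = (if int (mon_degree m) = d then lookup p m else 0)"
  by (auto simp: degree_part_def lookup_mapp when_def in_keys_iff)

lemma degree_part_zero [simp]: "degree_part d 0 = 0"
  by (rule poly_mapping_eqI) (simp add: lookup_degree_part)

lemma degree_part_add: "degree_part d (p + q) = degree_part d p + degree_part d q"
  by (rule poly_mapping_eqI) (simp add: lookup_degree_part lookup_add)

lemma degree_part_sum: "degree_part d (\<Sum>i\<in>A. f i) = (\<Sum>i\<in>A. degree_part d (f i))"
  by (induction A rule: infinite_finite_induct) (auto simp: degree_part_add)

lemma homogeneous_degree_part: "homogeneous d (degree_part d p)"
  by (auto simp: homogeneous_def in_keys_iff lookup_degree_part split: if_splits)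

lemma degree_part_homogeneous:
  assumes "homogeneous e p"
  shows "degree_part d p = (if d = e then p else 0)"
  using assms unfolding homogeneous_def
  by (intro poly_mapping_eqI) (auto simp: lookup_degree_part in_keys_iff)

lemma degree_part_decompose:
  assumes "finite D" "(\<lambda>m. int (mon_degree m)) ` keys p \<subseteq> D"
  shows "p = (\<Sum>d\<in>D. degree_part d p)"
proof (rule poly_mapping_eqI)
  fix m
  show "lookup p m = lookup (\<Sum>d\<in>D. degree_part d p) m"
    using assms by (cases "m \<in> keys p") (auto simp: lookup_sum lookup_degree_part in_keys_iff)
qed

definition graded_ideal :: "('x, 'k::field) mpoly set \<Rightarrow> bool" where
  "graded_ideal I \<longleftrightarrow> (\<forall>p\<in>I. \<forall>d. degree_part d p \<in> I)"

text \<open>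
  A product of components is homogeneous, so a component of \<open>p * q\<close> is a sum of such products.
\<close>
lemma degree_part_mult_in:
  fixes p q :: "('x::finite, 'k::field) mpoly"
  assumes "0 \<in> K" "\<And>a b. a \<in> K \<Longrightarrow> b \<in> K \<Longrightarrow> a + b \<in> K"
    and "\<And>i j. degree_part i p * degree_part j q \<in> K"
  shows "degree_part d (p * q) \<in> K"
proof -
  let ?D = "\<lambda>p :: ('x, 'k) mpoly. (\<lambda>m. int (mon_degree m)) ` keys p"
  have sumK: "(\<Sum>i\<in>A. f i) \<in> K" if "\<And>i. i \<in> A \<Longrightarrow> f i \<in> K" for A :: "int set" and f
    using that by (induction A rule: infinite_finite_induct) (auto intro: assms)
  have "p * q = (\<Sum>i\<in>?D p. degree_part i p) * (\<Sum>j\<in>?D q. degree_part j q)"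
    using degree_part_decompose[of "?D p" p] degree_part_decompose[of "?D q" q] by simp
  then have "p * q = (\<Sum>i\<in>?D p. \<Sum>j\<in>?D q. degree_part i p * degree_part j q)"
    by (simp add: sum_product)
  then have "degree_part d (p * q) = (\<Sum>i\<in>?D p. \<Sum>j\<in>?D q. degree_part d (degree_part i p * degree_part j q))"
    by (simp only: degree_part_sum)
  moreover have "degree_part d (degree_part i p * degree_part j q) = (if d = i + j then degree_part i p * degree_part j q else 0)" for i j
    by (rule degree_part_homogeneous[OF homogeneous_mult[OF homogeneous_degree_part homogeneous_degree_part]])
  then have "degree_part d (degree_part i p * degree_part j q) \<in> K" for i j using assms(1,3) by simp
  ultimately show ?thesis by (simp add: sumK)
qed

lemma graded_ideal_gen:
  fixes A :: "('x::finite, 'k::field) mpoly set"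
  assumes "\<And>a d. a \<in> A \<Longrightarrow> degree_part d a \<in> ideal_gen A"
  shows "graded_ideal (ideal_gen A)"
  unfolding graded_ideal_def
proof (intro ballI allI)
  fix p d assume "p \<in> ideal_gen A"
  then show "degree_part d p \<in> ideal_gen A"
  proof (induction rule: ideal_gen_induct)
    case zero
    then show ?case by (simp add: ideal_gen_zero)
  next
    case (step c a p)
    have "degree_part d (c * a) \<in> ideal_gen A"
      using assms[OF step(1)]
      by (intro degree_part_mult_in) (auto intro: ideal_gen_zero ideal_gen_add ideal_gen_mult)
    then show ?case using step by (simp add: degree_part_add ideal_gen_add)
  qed
qed

lemma graded_ideal_power:
  fixes I :: "('x::finite, 'k::field) mpoly set"
  assumes "graded_ideal I"
  shows "graded_ideal (ideal_power I s)"
proof (induction s)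
  case 0
  then show ?case by (simp add: graded_ideal_def)
next
  case (Suc s)
  show ?case unfolding ideal_power.simps
  proof (rule graded_ideal_gen)
    fix x d assume "x \<in> {a * b |a b. a \<in> I \<and> b \<in> ideal_power I s}"
    then obtain a b where ab: "x = a * b" "a \<in> I" "b \<in> ideal_power I s" by blast
    show "degree_part d x \<in> ideal_gen {a * b |a b. a \<in> I \<and> b \<in> ideal_power I s}"
      unfolding ab(1)
    proof (rule degree_part_mult_in)
      fix i j
      have "degree_part i a \<in> I" "degree_part j b \<in> ideal_power I s"
        using ab Suc assms unfolding graded_ideal_def by blast+
      then show "degree_part i a * degree_part j b \<in> ideal_gen {a * b |a b. a \<in> I \<and> b \<in> ideal_power I s}"
        by (intro ideal_gen_base) blast
    qed (auto intro: ideal_gen_zero ideal_gen_add)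
  qed
qed

lemma lookup_smul [simp]: "lookup (smul p v) b = p * lookup v b"
  by (simp add: smul_def Poly_Mapping.map.rep_eq when_def)

lemma smul_add_right: "smul p (v + w) = smul p v + smul p w"
  by (rule poly_mapping_eqI) (simp add: lookup_add distrib_left)

lemma smul_add_left: "smul (p + q) v = smul p v + smul q v"
  by (rule poly_mapping_eqI) (simp add: lookup_add distrib_right)

lemma smul_smul: "smul p (smul q v) = smul (p * q) v"
  by (rule poly_mapping_eqI) (simp add: mult.assoc)

lemma smul_zero_left [simp]: "smul 0 v = 0"
  by (rule poly_mapping_eqI) simp

lemma smul_zero_right [simp]: "smul p 0 = 0"
  by (rule poly_mapping_eqI) simp

lemma smul_one [simp]: "smul 1 v = v"
  by (rule poly_mapping_eqI) simp

lemma smul_minus: "smul (- p) v = - smul p v"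
  by (rule poly_mapping_eqI) simp

lemma smul_sum: "smul p (\<Sum>i\<in>A. f i) = (\<Sum>i\<in>A. smul p (f i))"
  by (induction A rule: infinite_finite_induct) (auto simp: smul_add_right)

lemma keys_smul: "keys (smul p v) \<subseteq> keys v"
  by (auto simp: in_keys_iff)

definition lin_map :: "(nat \<Rightarrow> (nat \<Rightarrow>\<^sub>0 'a)) \<Rightarrow> (nat \<Rightarrow>\<^sub>0 'a::comm_ring_1) \<Rightarrow> (nat \<Rightarrow>\<^sub>0 'a)" where
  "lin_map g v = (\<Sum>b\<in>keys v. smul (lookup v b) (g b))"

lemma bdry_map_lin_map: "bdry_map F i = lin_map (bdry F i)"
  by (simp add: fun_eq_iff bdry_map_def lin_map_def)

lemma lin_map_superset:
  assumes "finite X" "keys v \<subseteq> X"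
  shows "lin_map g v = (\<Sum>b\<in>X. smul (lookup v b) (g b))"
  unfolding lin_map_def using assms
  by (intro sum.mono_neutral_left) (auto simp: in_keys_iff)

lemma lin_map_zero [simp]: "lin_map g 0 = 0"
  by (simp add: lin_map_def)

lemma lin_map_add: "lin_map g (v + w) = lin_map g v + lin_map g w"
proof -
  let ?X = "keys v \<union> keys w"
  have "lin_map g (v + w) = (\<Sum>b\<in>?X. smul (lookup (v + w) b) (g b))"
    using keys_add[of v w] by (intro lin_map_superset) auto
  then show ?thesis
    by (simp add: lin_map_superset[of ?X] lookup_add smul_add_left sum.distrib)
qed

lemma lin_map_smul: "lin_map g (smul p v) = smul p (lin_map g v)"
proof -
  have "lin_map g (smul p v) = (\<Sum>b\<in>keys v. smul (lookup (smul p v) b) (g b))"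
    by (intro lin_map_superset keys_smul) simp
  then show ?thesis by (simp add: lin_map_def[of g v] smul_sum smul_smul)
qed

lemma lin_map_sum: "lin_map g (\<Sum>i\<in>A. f i) = (\<Sum>i\<in>A. lin_map g (f i))"
  by (induction A rule: infinite_finite_induct) (auto simp: lin_map_add)

lemma lin_map_single: "lin_map g (single b p) = smul p (g b)"
  by (subst lin_map_superset[of "{b}"]) auto

lemma lin_map_diff: "lin_map g (v - w) = lin_map g v - lin_map g w"
  using lin_map_add[of g "v - w" w] by (simp add: algebra_simps)

text \<open>The degrees of the basis elements are given by \<open>\<delta>\<close>.\<close>
definition hom_elt :: "(nat \<Rightarrow> int) \<Rightarrow> int \<Rightarrow> (nat \<Rightarrow>\<^sub>0 ('x, 'k::field) mpoly) \<Rightarrow> bool" where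
  "hom_elt \<delta> j v \<longleftrightarrow> (\<forall>b. homogeneous (j - \<delta> b) (lookup v b))"

lemma homogeneous_elt_hom_elt: "homogeneous_elt F i j = hom_elt (bdeg F i) j"
proof (intro ext iffI)
  fix v assume h: "homogeneous_elt F i j v"
  show "hom_elt (bdeg F i) j v"
    unfolding hom_elt_def
  proof
    fix b
    show "homogeneous (j - bdeg F i b) (lookup v b)"
      using h by (cases "b \<in> keys v") (auto simp: homogeneous_elt_def in_keys_iff)
  qed
qed (simp add: homogeneous_elt_def hom_elt_def)

lemma hom_elt_zero [simp]: "hom_elt \<delta> j 0"
  by (simp add: hom_elt_def)

lemma hom_elt_add: "hom_elt \<delta> j v \<Longrightarrow> hom_elt \<delta> j w \<Longrightarrow> hom_elt \<delta> j (v + w)"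
  by (simp add: hom_elt_def lookup_add homogeneous_add)

lemma hom_elt_sum: "(\<And>i. i \<in> A \<Longrightarrow> hom_elt \<delta> j (f i)) \<Longrightarrow> hom_elt \<delta> j (\<Sum>i\<in>A. f i)"
  by (induction A rule: infinite_finite_induct) (auto intro: hom_elt_add)

lemma hom_elt_smul:
  fixes p :: "('x::finite, 'k::field) mpoly"
  assumes "homogeneous i p" "hom_elt \<delta> j v" "l = i + j"
  shows "hom_elt \<delta> l (smul p v)"
  unfolding hom_elt_def
proof
  fix b
  have "homogeneous (i + (j - \<delta> b)) (p * lookup v b)"
    using assms by (intro homogeneous_mult) (auto simp: hom_elt_def)
  moreover have "i + (j - \<delta> b) = l - \<delta> b" using assms(3) by simp
  ultimately show "homogeneous (l - \<delta> b) (lookup (smul p v) b)" by simp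
qed

lemma hom_elt_lin_map:
  fixes v :: "nat \<Rightarrow>\<^sub>0 ('x::finite, 'k::field) mpoly"
  assumes "hom_elt \<delta> j v" "\<And>b. b \<in> keys v \<Longrightarrow> hom_elt \<delta>' (\<delta> b) (g b)"
  shows "hom_elt \<delta>' j (lin_map g v)"
  unfolding lin_map_def
proof (rule hom_elt_sum)
  fix b assume "b \<in> keys v"
  then show "hom_elt \<delta>' j (smul (lookup v b) (g b))"
    using assms by (intro hom_elt_smul[of "j - \<delta> b" _ _ "\<delta> b"]) (auto simp: hom_elt_def)
qed

definition elt_part :: "(nat \<Rightarrow> int) \<Rightarrow> int \<Rightarrow> (nat \<Rightarrow>\<^sub>0 ('x, 'k::field) mpoly) \<Rightarrow> (nat \<Rightarrow>\<^sub>0 ('x, 'k) mpoly)" where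
  "elt_part \<delta> j v = Poly_Mapping.mapp (\<lambda>b p. degree_part (j - \<delta> b) p) v"

lemma lookup_elt_part: "lookup (elt_part \<delta> j v) b = degree_part (j - \<delta> b) (lookup v b)"
  by (auto simp: elt_part_def lookup_mapp when_def in_keys_iff)

lemma keys_elt_part: "keys (elt_part \<delta> j v) \<subseteq> keys v"
  unfolding elt_part_def by (rule keys_mapp_subset)

lemma elt_part_zero [simp]: "elt_part \<delta> j 0 = 0"
  by (rule poly_mapping_eqI) (simp add: lookup_elt_part)

lemma elt_part_add: "elt_part \<delta> j (v + w) = elt_part \<delta> j v + elt_part \<delta> j w"
  by (rule poly_mapping_eqI) (simp add: lookup_elt_part lookup_add degree_part_add)

lemma elt_part_sum: "elt_part \<delta> j (\<Sum>i\<in>A. f i) = (\<Sum>i\<in>A. elt_part \<delta> j (f i))"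
  by (induction A rule: infinite_finite_induct) (auto simp: elt_part_add)

lemma hom_elt_elt_part: "hom_elt \<delta> j (elt_part \<delta> j v)"
  by (simp add: hom_elt_def lookup_elt_part homogeneous_degree_part)

lemma elt_part_hom_elt:
  assumes "hom_elt \<delta> i v"
  shows "elt_part \<delta> j v = (if j = i then v else 0)"
proof (rule poly_mapping_eqI)
  fix b
  have "degree_part (j - \<delta> b) (lookup v b) = (if j - \<delta> b = i - \<delta> b then lookup v b else 0)"
    using assms by (intro degree_part_homogeneous) (auto simp: hom_elt_def)
  then show "lookup (elt_part \<delta> j v) b = lookup (if j = i then v else 0) b"
    by (simp add: lookup_elt_part)
qed

lemma elt_part_decompose:
  fixes v :: "nat \<Rightarrow>\<^sub>0 ('x, 'k::field) mpoly"
  shows "\<exists>J. finite J \<and> j \<in> J \<and> v = (\<Sum>i\<in>J. elt_part \<delta> i v)"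
proof -
  define J where "J = insert j (\<Union>b\<in>keys v. (\<lambda>m. \<delta> b + int (mon_degree m)) ` keys (lookup v b))"
  have fin: "finite J" by (simp add: J_def)
  have "lookup v b = lookup (\<Sum>i\<in>J. elt_part \<delta> i v) b" for b
  proof (cases "b \<in> keys v")
    case True
    let ?D = "(\<lambda>i. i - \<delta> b) ` J"
    have "lookup v b = (\<Sum>d\<in>?D. degree_part d (lookup v b))"
      using fin True by (intro degree_part_decompose) (force simp: J_def)+
    also have "\<dots> = (\<Sum>i\<in>J. degree_part (i - \<delta> b) (lookup v b))"
      by (subst sum.reindex) (auto simp: inj_on_def)
    finally show ?thesis by (simp add: lookup_sum lookup_elt_part)
  next
    case False
    then show ?thesis by (simp add: lookup_sum lookup_elt_part in_keys_iff)
  qed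
  then have "v = (\<Sum>i\<in>J. elt_part \<delta> i v)" by (rule poly_mapping_eqI)
  then show ?thesis using fin by (intro exI[of _ J]) (auto simp: J_def)
qed

text \<open>
  Maps of degree 0 commute with taking components, which makes kernels graded and lets
  preimages of homogeneous elements be chosen homogeneous.
\<close>
lemma lin_map_elt_part:
  fixes v :: "nat \<Rightarrow>\<^sub>0 ('x::finite, 'k::field) mpoly"
  assumes "\<And>b. b \<in> keys v \<Longrightarrow> hom_elt \<delta>' (\<delta> b) (g b)"
  shows "lin_map g (elt_part \<delta> j v) = elt_part \<delta>' j (lin_map g v)"
proof -
  obtain J where J: "finite J" "j \<in> J" "v = (\<Sum>i\<in>J. elt_part \<delta> i v)"
    using elt_part_decompose by blast
  have h: "hom_elt \<delta>' i (lin_map g (elt_part \<delta> i v))" for i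
    using assms keys_elt_part[of \<delta> i v] by (intro hom_elt_lin_map[OF hom_elt_elt_part]) auto
  have "lin_map g v = (\<Sum>i\<in>J. lin_map g (elt_part \<delta> i v))"
    using arg_cong[OF J(3), of "lin_map g"] by (simp only: lin_map_sum)
  then have "elt_part \<delta>' j (lin_map g v) = (\<Sum>i\<in>J. elt_part \<delta>' j (lin_map g (elt_part \<delta> i v)))"
    by (simp only: elt_part_sum)
  also have "\<dots> = (\<Sum>i\<in>J. if j = i then lin_map g (elt_part \<delta> i v) else 0)"
    using elt_part_hom_elt[OF h] by simp
  also have "\<dots> = lin_map g (elt_part \<delta> j v)" using J by simp
  finally show ?thesis ..
qed

definition graded_submodule :: "(nat \<Rightarrow> int) \<Rightarrow> (nat \<Rightarrow>\<^sub>0 ('x, 'k::field) mpoly) set \<Rightarrow> bool" where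
  "graded_submodule \<delta> Z \<longleftrightarrow> 0 \<in> Z \<and> (\<forall>v\<in>Z. \<forall>w\<in>Z. v + w \<in> Z) \<and> (\<forall>p. \<forall>v\<in>Z. smul p v \<in> Z) \<and>
     (\<forall>j. \<forall>v\<in>Z. elt_part \<delta> j v \<in> Z)"

lemma graded_submodule_sum:
  "graded_submodule \<delta> Z \<Longrightarrow> (\<And>i. i \<in> A \<Longrightarrow> f i \<in> Z) \<Longrightarrow> (\<Sum>i\<in>A. f i) \<in> Z"
  by (induction A rule: infinite_finite_induct) (auto simp: graded_submodule_def)

text \<open>
  The free module is a vector space with basis the pairs of a basis index and a monomial.
\<close>
definition terms :: "(nat \<Rightarrow>\<^sub>0 ('x, 'k::field) mpoly) \<Rightarrow> (nat \<times> ('x \<Rightarrow>\<^sub>0 nat)) set" where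
  "terms v = {(b, m). m \<in> keys (lookup v b)}"

lemma finite_terms: "finite (terms v)"
proof -
  have "terms v \<subseteq> (SIGMA b:keys v. keys (lookup v b))"
    by (auto simp: terms_def in_keys_iff)
  then show ?thesis by (rule finite_subset) auto
qed

lemma terms_nonempty: "v \<noteq> 0 \<Longrightarrow> terms v \<noteq> {}"
proof -
  assume "v \<noteq> 0"
  then obtain b where "lookup v b \<noteq> 0" by (metis poly_mapping_eqI lookup_zero)
  then obtain m where "lookup (lookup v b) m \<noteq> 0" by (metis poly_mapping_eqI lookup_zero)
  then show ?thesis by (auto simp: terms_def in_keys_iff)
qed

text \<open>
  The enumeration plays the role of a term order in the choice of generators of graded submodules.
\<close>
lemma ex_term_enumeration: "\<exists>\<iota> :: nat \<times> ('x::finite \<Rightarrow>\<^sub>0 nat) \<Rightarrow> nat. inj \<iota>"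
proof -
  have "inj (\<lambda>(b :: nat, m :: 'x \<Rightarrow>\<^sub>0 nat). to_nat (b, lookup m))"
    by (auto simp: inj_def)
  then show ?thesis by blast
qed

text \<open>
  The resolution has its bases indexed by natural numbers, so a graded submodule needs countably
  many homogeneous generators, whatever the cardinality of the field. Enumerate the terms by natural numbers
  and choose, for each number that is the leading index of a homogeneous element of \<open>Z\<close>, one such element.
  Subtracting multiples of the chosen elements lowers the leading index, and induction shows that
  they span \<open>Z\<close> even over \<open>k\<close>.
\<close>
lemma homogeneous_generators:
  fixes Z :: "(nat \<Rightarrow>\<^sub>0 ('x::finite, 'k::field) mpoly) set"
  assumes Z: "graded_submodule \<delta> Z"
  shows "\<exists>B \<delta>' g. (\<forall>b\<in>B. g b \<in> Z \<and> hom_elt \<delta> (\<delta>' b) (g b)) \<and> lin_map g ` {v. keys v \<subseteq> B} = Z"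
proof -
  obtain \<iota> :: "nat \<times> ('x \<Rightarrow>\<^sub>0 nat) \<Rightarrow> nat" where inj: "inj \<iota>" using ex_term_enumeration by blast
  define lt where "lt v = Max (\<iota> ` terms v)" for v :: "nat \<Rightarrow>\<^sub>0 ('x, 'k) mpoly"
  define P where "P n v j \<longleftrightarrow> v \<in> Z \<and> v \<noteq> 0 \<and> hom_elt \<delta> j v \<and> lt v = n" for n v j
  define B where "B = {n. \<exists>v j. P n v j}"
  have "\<forall>n. \<exists>v j. n \<in> B \<longrightarrow> P n v j" by (auto simp: B_def)
  then obtain g \<delta>' where g: "\<And>n. n \<in> B \<Longrightarrow> P n (g n) (\<delta>' n)" by metis
  define U where "U = lin_map g ` {v. keys v \<subseteq> B}"
  have U_add: "v + w \<in> U" if "v \<in> U" "w \<in> U" for v w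
  proof -
    obtain v' w' where vw: "v = lin_map g v'" "keys v' \<subseteq> B" "w = lin_map g w'" "keys w' \<subseteq> B"
      using \<open>v \<in> U\<close> \<open>w \<in> U\<close> unfolding U_def by auto
    have "v + w = lin_map g (v' + w')" by (simp add: lin_map_add vw)
    moreover have "keys (v' + w') \<subseteq> B" using vw keys_add[of v' w'] by blast
    ultimately show ?thesis unfolding U_def by blast
  qed
  have U_gen: "smul p (g n) \<in> U" if "n \<in> B" for n p
    unfolding U_def using lin_map_single[of g n p] that by (intro image_eqI[of _ _ "single n p"]) auto
  have U_zero: "0 \<in> U" unfolding U_def by (intro image_eqI[of _ _ 0]) auto
  have hom_in: "v \<in> U" if "v \<in> Z" "hom_elt \<delta> j v" for v j
    using that
  proof (induction "lt v" arbitrary: v rule: less_induct)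
    case less
    show ?case
    proof (cases "v = 0")
      case True
      then show ?thesis by (simp add: U_zero)
    next
      case False
      let ?n = "lt v"
      have Pv: "P ?n v j" using less False by (simp add: P_def)
      then have nB: "?n \<in> B" by (auto simp: B_def)
      let ?u = "g ?n"
      have u: "?u \<in> Z" "?u \<noteq> 0" "hom_elt \<delta> (\<delta>' ?n) ?u" "lt ?u = ?n"
        using g[OF nB] by (auto simp: P_def)
      have top: "\<exists>t\<in>terms x. \<iota> t = lt x" if "x \<noteq> 0" for x
      proof -
        have "lt x \<in> \<iota> ` terms x"
          unfolding lt_def using finite_terms[of x] terms_nonempty[OF that] by (intro Max_in) auto
        then show ?thesis by auto
      qed
      obtain b m where bm: "(b, m) \<in> terms v" "\<iota> (b, m) = ?n" using top[OF False] by force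
      obtain b' m' where "(b', m') \<in> terms ?u" "\<iota> (b', m') = ?n" using top[OF u(2)] u(4) by force
      then have bm': "(b, m) \<in> terms ?u" using bm inj by (metis injD)
      let ?c = "lookup (lookup v b) m" and ?c' = "lookup (lookup ?u b) m"
      have c: "?c \<noteq> 0" "?c' \<noteq> 0" using bm(1) bm' by (auto simp: terms_def in_keys_iff)
      have "int (mon_degree m) = j - \<delta> b" "int (mon_degree m) = \<delta>' ?n - \<delta> b"
        using less(3) u(3) bm(1) bm' unfolding hom_elt_def homogeneous_def terms_def by blast+
      \<comment> \<open>\<open>v\<close> and the chosen element share the term \<open>(b, m)\<close>, which determines the degree of both.\<close>
      then have deg: "\<delta>' ?n = j" by simp
      define a where "a = - (?c / ?c')"
      define w where "w = v + smul (const a) ?u"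
      have wZ: "w \<in> Z" using Z less(2) u(1) by (simp add: w_def graded_submodule_def)
      have wh: "hom_elt \<delta> j w"
        unfolding w_def using u(3) deg less(3)
        by (intro hom_elt_add hom_elt_smul[of 0 _ _ j] homogeneous_const) auto
      have lw: "lookup (lookup w y) x = lookup (lookup v y) x + a * lookup (lookup ?u y) x" for x y
        by (simp add: w_def lookup_add lookup_const_mult)
      have "w \<in> U"
      proof (cases "w = 0")
        case True
        then show ?thesis by (simp add: U_zero)
      next
        case wne: False
        have sub: "t \<in> terms v \<union> terms ?u - {(b, m)}" if "t \<in> terms w" for t
          using that c by (auto simp: terms_def in_keys_iff lw a_def)
        have "\<iota> t < ?n" if "t \<in> terms w" for t
        proof -
          have t: "t \<in> terms v \<union> terms ?u - {(b, m)}" by (rule sub[OF that])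
          then have "\<iota> t \<le> lt v \<or> \<iota> t \<le> lt ?u"
            unfolding lt_def using finite_terms by (metis Diff_iff Max_ge UnE finite_imageI imageI)
          moreover have "\<iota> t \<noteq> ?n" using t bm(2) inj by (metis Diff_iff injD singletonI)
          ultimately show ?thesis using u(4) by linarith
        qed
        then have "lt w < lt v" using top[OF wne] by metis
        then show ?thesis using less(1) wZ wh by blast
      qed
      moreover have "v = w + smul (const (- a)) ?u"
        by (rule poly_mapping_eqI, rule poly_mapping_eqI)
          (simp add: lookup_add lw lookup_const_mult)
      ultimately show ?thesis using U_add U_gen[OF nB] by metis
    qed
  qed
  have "Z \<subseteq> U"
  proof
    fix v assume v: "v \<in> Z"
    obtain J where J: "finite J" "v = (\<Sum>i\<in>J. elt_part \<delta> i v)" using elt_part_decompose[of 0] by blast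
    have "elt_part \<delta> i v \<in> U" for i
      using v Z hom_in[OF _ hom_elt_elt_part] unfolding graded_submodule_def by blast
    then have "(\<Sum>i\<in>J. elt_part \<delta> i v) \<in> U"
      by (induction J rule: infinite_finite_induct) (auto intro: U_zero U_add)
    then show "v \<in> U" using J(2) by simp
  qed
  moreover have "U \<subseteq> Z"
  proof
    fix v assume "v \<in> U"
    then obtain v' where v': "v = lin_map g v'" "keys v' \<subseteq> B" unfolding U_def by blast
    show "v \<in> Z" unfolding v' lin_map_def
      using v'(2) g Z by (intro graded_submodule_sum[OF Z]) (auto simp: P_def graded_submodule_def)
  qed
  ultimately show ?thesis using g unfolding U_def P_def by (intro exI[of _ B] exI[of _ \<delta>'] exI[of _ g]) blast
qed

lemma graded_submodule_kernel:
  fixes g :: "nat \<Rightarrow> (nat \<Rightarrow>\<^sub>0 ('x::finite, 'k::field) mpoly)"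
  assumes "\<And>b. b \<in> B \<Longrightarrow> hom_elt \<delta> (\<delta>' b) (g b)"
  shows "graded_submodule \<delta>' {v. keys v \<subseteq> B \<and> lin_map g v = 0}"
  unfolding graded_submodule_def
proof (intro conjI ballI allI)
  fix v w :: "nat \<Rightarrow>\<^sub>0 ('x, 'k) mpoly" and j p
  assume v: "v \<in> {v. keys v \<subseteq> B \<and> lin_map g v = 0}"
  show "smul p v \<in> {v. keys v \<subseteq> B \<and> lin_map g v = 0}"
    using v keys_smul[of p v] by (auto simp: lin_map_smul)
  have "lin_map g (elt_part \<delta>' j v) = elt_part \<delta> j (lin_map g v)" using assms v by (intro lin_map_elt_part) auto
  then show "elt_part \<delta>' j v \<in> {v. keys v \<subseteq> B \<and> lin_map g v = 0}"
    using v keys_elt_part[of \<delta>' j v] by auto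
  assume w: "w \<in> {v. keys v \<subseteq> B \<and> lin_map g v = 0}"
  then show "v + w \<in> {v. keys v \<subseteq> B \<and> lin_map g v = 0}"
    using v keys_add[of v w] by (auto simp: lin_map_add)
qed auto

text \<open>
  Resolve step by step: each kernel is a graded submodule and hence the image of a graded free module.
  Starting from \<open>F\<^sub>0 = S\<close> makes the augmentation a coordinate.
\<close>
lemma graded_free_resolution_exists:
  fixes I :: "('x::finite, 'k::field) mpoly set"
  assumes I: "is_ideal I" and graded: "graded_ideal I"
  shows "\<exists>F. graded_free_resolution I F \<and> basis F 0 = {0} \<and> bdeg F 0 = (\<lambda>_. 0) \<and> aug F = (\<lambda>_. 1)"
proof -
  have zero: "0 \<in> I" and add: "\<And>p q. p \<in> I \<Longrightarrow> q \<in> I \<Longrightarrow> p + q \<in> I"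
    and mult: "\<And>c p. p \<in> I \<Longrightarrow> c * p \<in> I"
    using I by (auto simp: is_ideal_def)
  let ?Z0 = "{v :: nat \<Rightarrow>\<^sub>0 ('x, 'k) mpoly. keys v \<subseteq> {0} \<and> lookup v 0 \<in> I}"
  \<comment> \<open>A state consists of a basis, its degrees, and the submodule that the next map has to hit.\<close>
  define x0 where "x0 = ({0 :: nat}, (\<lambda>_ :: nat. 0 :: int), ?Z0)"
  define inv where "inv = (\<lambda>(B :: nat set, \<delta> :: nat \<Rightarrow> int, Z :: (nat \<Rightarrow>\<^sub>0 ('x, 'k) mpoly) set).
      Z \<subseteq> {v. keys v \<subseteq> B} \<and> graded_submodule \<delta> Z)"
  define Q where "Q = (\<lambda>(B :: nat set, \<delta> :: nat \<Rightarrow> int, Z :: (nat \<Rightarrow>\<^sub>0 ('x, 'k) mpoly) set)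
      (B' :: nat set, \<delta>' :: nat \<Rightarrow> int, Z' :: (nat \<Rightarrow>\<^sub>0 ('x, 'k) mpoly) set).
      \<exists>g. (\<forall>b\<in>B'. g b \<in> Z \<and> hom_elt \<delta> (\<delta>' b) (g b)) \<and> lin_map g ` {v. keys v \<subseteq> B'} = Z \<and>
          Z' = {v. keys v \<subseteq> B' \<and> lin_map g v = 0})"
  have "inv x0"
  proof -
    have "keys v \<subseteq> {0} \<Longrightarrow> keys w \<subseteq> {0} \<Longrightarrow> keys (v + w) \<subseteq> {0}" for v w :: "nat \<Rightarrow>\<^sub>0 ('x, 'k) mpoly"
      using keys_add[of v w] by blast
    moreover have "keys v \<subseteq> {0} \<Longrightarrow> keys (smul p v) \<subseteq> {0}" for v :: "nat \<Rightarrow>\<^sub>0 ('x, 'k) mpoly" and p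
      using keys_smul[of p v] by blast
    moreover have "keys v \<subseteq> {0} \<Longrightarrow> keys (elt_part (\<lambda>_. 0) j v) \<subseteq> {0}" for v :: "nat \<Rightarrow>\<^sub>0 ('x, 'k) mpoly" and j
      using keys_elt_part[of "\<lambda>_. 0" j v] by blast
    ultimately show ?thesis
      using zero add mult graded
      by (auto simp: inv_def x0_def graded_submodule_def lookup_add lookup_elt_part graded_ideal_def)
  qed
  have step: "\<exists>y. inv y \<and> Q x y" if "inv x" for x
  proof -
    obtain B \<delta> Z where x: "x = (B, \<delta>, Z)" by (cases x)
    then have "graded_submodule \<delta> Z" using that by (simp add: inv_def)
    then obtain B' \<delta>' g where g: "\<forall>b\<in>B'. g b \<in> Z \<and> hom_elt \<delta> (\<delta>' b) (g b)"
        "lin_map g ` {v. keys v \<subseteq> B'} = Z"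
      using homogeneous_generators[of \<delta> Z] by metis
    let ?Z' = "{v. keys v \<subseteq> B' \<and> lin_map g v = 0}"
    have "graded_submodule \<delta>' ?Z'" using g by (intro graded_submodule_kernel) auto
    then have "inv (B', \<delta>', ?Z')" by (auto simp: inv_def)
    moreover have "Q x (B', \<delta>', ?Z')" unfolding x Q_def using g by (auto intro!: exI[of _ g])
    ultimately show ?thesis by blast
  qed
  obtain f where f: "\<And>n. inv (f n) \<and> (n = 0 \<longrightarrow> f n = x0)" "\<And>n. Q (f n) (f (Suc n))"
    using dependent_nat_choice[of "\<lambda>n x. inv x \<and> (n = 0 \<longrightarrow> x = x0)" "\<lambda>n. Q"] \<open>inv x0\<close> step
    by (metis nat.distinct(1))
  define B where "B n = fst (f n)" for n
  define \<delta> where "\<delta> n = fst (snd (f n))" for n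
  define Z where "Z n = snd (snd (f n))" for n
  have fn: "f n = (B n, \<delta> n, Z n)" for n by (simp add: B_def \<delta>_def Z_def)
  have "\<forall>n. \<exists>g. (\<forall>b\<in>B (Suc n). g b \<in> Z n \<and> hom_elt (\<delta> n) (\<delta> (Suc n) b) (g b)) \<and>
      lin_map g ` {v. keys v \<subseteq> B (Suc n)} = Z n \<and> Z (Suc n) = {v. keys v \<subseteq> B (Suc n) \<and> lin_map g v = 0}"
    using f(2) by (simp add: fn Q_def)
  from choice[OF this] obtain g where
    gg: "\<forall>n. (\<forall>b\<in>B (Suc n). g n b \<in> Z n \<and> hom_elt (\<delta> n) (\<delta> (Suc n) b) (g n b)) \<and>
      lin_map (g n) ` {v. keys v \<subseteq> B (Suc n)} = Z n \<and>
      Z (Suc n) = {v. keys v \<subseteq> B (Suc n) \<and> lin_map (g n) v = 0}"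
    by (elim exE)
  have g: "b \<in> B (Suc n) \<Longrightarrow> g n b \<in> Z n \<and> hom_elt (\<delta> n) (\<delta> (Suc n) b) (g n b)"
    "lin_map (g n) ` {v. keys v \<subseteq> B (Suc n)} = Z n"
    "Z (Suc n) = {v. keys v \<subseteq> B (Suc n) \<and> lin_map (g n) v = 0}" for n b
    using spec[OF gg, of n] by simp_all
  have ZB: "Z n \<subseteq> {v. keys v \<subseteq> B n}" for n using f(1)[of n] by (simp add: fn inv_def)
  have "f 0 = x0" using f(1)[of 0] by simp
  then have zero_level: "B 0 = {0}" "\<delta> 0 = (\<lambda>_. 0)" "Z 0 = ?Z0" by (simp_all add: fn x0_def)
  define F :: "('x, 'k) free_complex" where
    "F = \<lparr>basis = B, bdeg = \<delta>, bdry = g, aug = (\<lambda>_. 1)\<rparr>"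
  have F_sel: "basis F = B" "bdeg F = \<delta>" "bdry F = g" "aug F = (\<lambda>_. 1)" by (simp_all add: F_def)
  have fm: "free_mod F i = {v. keys v \<subseteq> B i}" for i by (simp add: free_mod_def F_sel)
  have aug: "aug_map F v = lookup v 0" if "v \<in> free_mod F 0" for v
  proof -
    have "aug_map F v = (\<Sum>b\<in>{0}. lookup v b * aug F b)"
      unfolding aug_map_def using that
      by (intro sum.mono_neutral_left) (auto simp: fm zero_level in_keys_iff)
    then show ?thesis by (simp add: F_sel)
  qed
  have "graded_free_resolution I F"
    unfolding graded_free_resolution_def
  proof (intro conjI allI ballI)
    fix i b assume "b \<in> basis F (Suc i)"
    then have b: "b \<in> B (Suc i)" by (simp add: F_sel)
    show "bdry F i b \<in> free_mod F i" using g(1)[OF b] ZB[of i] by (auto simp: fm F_sel)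
    show "homogeneous_elt F i (bdeg F (Suc i) b) (bdry F i b)"
      using g(1)[OF b] by (simp add: homogeneous_elt_hom_elt F_sel)
  next
    fix b show "homogeneous (bdeg F 0 b) (aug F b)"
      by (simp add: F_sel zero_level homogeneous_one)
  next
    fix p
    have s: "single 0 p \<in> free_mod F 0" by (simp add: fm zero_level)
    then have "p - aug_map F (single 0 p) = 0" by (simp add: aug)
    then show "\<exists>v\<in>free_mod F 0. p - aug_map F v \<in> I" using s zero by metis
  next
    have "{v \<in> free_mod F 0. aug_map F v \<in> I} = Z 0"
      using aug by (auto simp: fm zero_level)
    then show "bdry_map F 0 ` free_mod F 1 = {v \<in> free_mod F 0. aug_map F v \<in> I}"
      using g(2)[of 0] by (simp add: fm bdry_map_lin_map F_sel)
  next
    fix i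
    show "bdry_map F (Suc i) ` free_mod F (Suc (Suc i)) = {v \<in> free_mod F (Suc i). bdry_map F i v = 0}"
      using g(2)[of "Suc i"] g(3)[of i] by (simp add: fm bdry_map_lin_map F_sel)
  qed
  moreover have "basis F 0 = {0}" "bdeg F 0 = (\<lambda>_. 0)" "aug F = (\<lambda>_. 1)"
    by (simp_all add: F_sel zero_level)
  ultimately show ?thesis by blast
qed

section \<open>A nonzero Tor module from a flag of ideals\<close>

lemma is_ideal_irrelevant: "is_ideal (irrelevant_ideal :: ('x, 'k::field) mpoly set)"
  unfolding is_ideal_def irrelevant_ideal_def
proof (intro conjI ballI allI)
  fix c p :: "('x, 'k) mpoly"
  assume p: "p \<in> {p. lookup p 0 = 0}"
  have "0 \<notin> keys (c * p)"
  proof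
    assume "0 \<in> keys (c * p)"
    then obtain a b where ab: "0 = a + b" "b \<in> keys p" using keys_mult by blast
    have "b = 0"
    proof (rule poly_mapping_eqI)
      fix x
      have "lookup (a + b) x = 0" using ab(1) by simp
      then show "lookup b x = lookup 0 x" by (simp add: lookup_add)
    qed
    then show False using ab(2) p by (simp add: in_keys_iff)
  qed
  then show "c * p \<in> {p. lookup p 0 = 0}" by (simp add: in_keys_iff)
qed (auto simp: lookup_add)

lemma free_mod_zero: "0 \<in> free_mod F i"
  by (simp add: free_mod_def)

lemma free_mod_add: "v \<in> free_mod F i \<Longrightarrow> w \<in> free_mod F i \<Longrightarrow> v + w \<in> free_mod F i"
  using keys_add[of v w] by (auto simp: free_mod_def)

lemma free_mod_smul: "v \<in> free_mod F i \<Longrightarrow> smul p v \<in> free_mod F i"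
  using keys_smul[of p v] by (auto simp: free_mod_def)

lemma free_mod_diff: "v \<in> free_mod F i \<Longrightarrow> w \<in> free_mod F i \<Longrightarrow> v - w \<in> free_mod F i"
  using free_mod_add[of v F i "smul (- 1) w"] free_mod_smul[of w F i "- 1"] by (simp add: smul_minus)

lemma free_mod_sum: "(\<And>a. a \<in> A \<Longrightarrow> f a \<in> free_mod F i) \<Longrightarrow> (\<Sum>a\<in>A. f a) \<in> free_mod F i"
  by (induction A rule: infinite_finite_induct) (auto intro: free_mod_add free_mod_zero)

lemma lin_map_in_ideal:
  assumes "is_ideal I" "\<And>b. lookup v b \<in> I"
  shows "lookup (lin_map g v) x \<in> I"
  unfolding lin_map_def lookup_sum using assms by (auto intro!: is_ideal_sum is_ideal_mult_right)

text \<open>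
  The sign of the basis element \<open>A - {a}\<close> in the Koszul boundary of \<open>A\<close>.
\<close>
definition koszul_sign :: "nat set \<Rightarrow> nat \<Rightarrow> 'a::comm_ring_1" where
  "koszul_sign A a = (- 1) ^ card {c \<in> A. c < a}"

lemma koszul_sign_antisym:
  assumes "finite A" "a \<in> A" "c \<in> A" "a \<noteq> c"
  shows "koszul_sign A a * koszul_sign (A - {a}) c = - (koszul_sign A c * koszul_sign (A - {c}) a)"
proof -
  have *: "koszul_sign A a * koszul_sign (A - {a}) c = - (koszul_sign A c * koszul_sign (A - {c}) a :: 'a)"
    if "a \<in> A" "c \<in> A" "c < a" for a c
  proof -
    have 1: "{d \<in> A - {a}. d < c} = {d \<in> A. d < c}" using that by auto
    have 2: "{d \<in> A. d < a} = insert c {d \<in> A - {c}. d < a}" using that by auto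
    have 3: "card {d \<in> A. d < a} = Suc (card {d \<in> A - {c}. d < a})"
      unfolding 2 using assms(1) by (subst card_insert_disjoint) auto
    show ?thesis unfolding koszul_sign_def 1 3 by simp
  qed
  show ?thesis using *[of a c] *[of c a] assms by (cases "c < a") auto
qed

lemma sum_antisym_zero:
  fixes T :: "'b \<Rightarrow> 'b \<Rightarrow> 'a::ab_group_add"
  assumes "finite A" "\<And>a c. a \<in> A \<Longrightarrow> c \<in> A \<Longrightarrow> a \<noteq> c \<Longrightarrow> T a c = - T c a"
  shows "(\<Sum>a\<in>A. \<Sum>c\<in>A - {a}. T a c) = 0"
  using assms
proof (induction A)
  case empty
  then show ?case by simp
next
  case (insert x A)
  have "(\<Sum>c\<in>insert x A - {a}. T a c) = T a x + (\<Sum>c\<in>A - {a}. T a c)" if "a \<in> A" for a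
  proof -
    have "insert x A - {a} = insert x (A - {a})" using that insert(2) by auto
    then show ?thesis using insert(1,2) by simp
  qed
  then have "(\<Sum>a\<in>insert x A. \<Sum>c\<in>insert x A - {a}. T a c) =
      (\<Sum>c\<in>A. T x c) + (\<Sum>a\<in>A. T a x) + (\<Sum>a\<in>A. \<Sum>c\<in>A - {a}. T a c)"
    using insert(1,2) by (simp add: sum.distrib add.assoc)
  also have "(\<Sum>a\<in>A. \<Sum>c\<in>A - {a}. T a c) = 0" by (intro insert.IH insert.prems) auto
  also have "(\<Sum>a\<in>A. T a x) = - (\<Sum>c\<in>A. T x c)"
    unfolding sum_negf[symmetric]
    using insert(2) by (intro sum.cong refl insert.prems) auto
  finally show ?case by simp
qed

text \<open>
  Modulo \<open>Q e\<close>, the ring \<open>S\<close> is thought of as a polynomial ring in \<open>Y 0, ..., Y (e - 1)\<close>, and \<open>Q j\<close> as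
  the ideal of the variables from \<open>Y j\<close> on. The assumptions on \<open>Q\<close> are what the descent through the
  resolution uses: \<open>Y j\<close> generates \<open>Q j\<close> modulo \<open>Q (j + 1)\<close> and is regular there, and
  the \<open>f j\<close> are triangular with diagonal entries \<open>Y j * Y j\<close>.
\<close>
locale flag_setup =
  fixes J :: "('x::finite, 'k::field) mpoly set" and F :: "('x, 'k) free_complex"
    and f Y :: "nat \<Rightarrow> ('x, 'k) mpoly" and Q :: "nat \<Rightarrow> ('x, 'k) mpoly set"
    and g :: "('x, 'k) mpoly" and e :: nat and h :: int
  assumes J: "is_ideal J"
    and res: "graded_free_resolution J F"
    and F0: "basis F 0 = {0}" "bdeg F 0 = (\<lambda>_. 0)" "aug F = (\<lambda>_. 1)"
    and g: "homogeneous h g"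
    and f: "\<And>a. a < e \<Longrightarrow> homogeneous 2 (f a)"
    and gf: "\<And>a. a < e \<Longrightarrow> f a * g \<in> J"
    and Q: "\<And>j. is_ideal (Q j)"
    and Q0: "irrelevant_ideal \<subseteq> Q 0"
    and Q_split: "\<And>j p. j < e \<Longrightarrow> p \<in> Q j \<Longrightarrow> \<exists>u. p - Y j * u \<in> Q (Suc j)"
    and Q_cancel: "\<And>j p. j < e \<Longrightarrow> Y j * p \<in> Q (Suc j) \<Longrightarrow> p \<in> Q (Suc j)"
    and Q_diag: "\<And>j. j < e \<Longrightarrow> f j - Y j * Y j \<in> Q (Suc j)"
    and Q_later: "\<And>j a. j < a \<Longrightarrow> a < e \<Longrightarrow> f a \<in> Q (Suc j)"
    and notin: "\<And>q. q \<in> Q e \<Longrightarrow> (\<Prod>j<e. Y j) * g - q \<notin> J"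
begin

abbreviation "dd \<equiv> bdry_map F"

lemma dd_add: "dd i (v + w) = dd i v + dd i w" by (simp add: bdry_map_lin_map lin_map_add)
lemma dd_diff: "dd i (v - w) = dd i v - dd i w" by (simp add: bdry_map_lin_map lin_map_diff)
lemma dd_smul: "dd i (smul p v) = smul p (dd i v)" by (simp add: bdry_map_lin_map lin_map_smul)
lemma dd_sum: "dd i (\<Sum>a\<in>A. u a) = (\<Sum>a\<in>A. dd i (u a))" by (simp add: bdry_map_lin_map lin_map_sum)

text \<open>
  The cycles of the augmented complex: in position 0 the map to \<open>S/J\<close> takes the place of the boundary.
\<close>
definition is_cycle :: "nat \<Rightarrow> (nat \<Rightarrow>\<^sub>0 ('x, 'k) mpoly) \<Rightarrow> bool" where
  "is_cycle n v \<longleftrightarrow> (case n of 0 \<Rightarrow> lookup v 0 \<in> J | Suc i \<Rightarrow> dd i v = 0)"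

lemma aug_eq: "v \<in> free_mod F 0 \<Longrightarrow> aug_map F v = lookup v 0"
proof -
  assume "v \<in> free_mod F 0"
  then have "aug_map F v = (\<Sum>b\<in>{0}. lookup v b * aug F b)"
    unfolding aug_map_def free_mod_def
    by (intro sum.mono_neutral_left) (auto simp: F0 in_keys_iff)
  then show ?thesis by (simp add: F0)
qed

lemma exact: "dd n ` free_mod F (Suc n) = {v \<in> free_mod F n. is_cycle n v}"
proof (cases n)
  case 0
  then show ?thesis using res aug_eq unfolding graded_free_resolution_def is_cycle_def by auto
next
  case (Suc i)
  then show ?thesis using res unfolding graded_free_resolution_def is_cycle_def by simp
qed

lemma dd_free: "v \<in> free_mod F (Suc n) \<Longrightarrow> dd n v \<in> free_mod F n"
  using exact[of n] by blast

lemma dd_is_cycle: "v \<in> free_mod F (Suc n) \<Longrightarrow> is_cycle n (dd n v)"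
  using exact[of n] by blast

lemma bdry_homogeneous:
  "b \<in> basis F (Suc n) \<Longrightarrow> hom_elt (bdeg F n) (bdeg F (Suc n) b) (bdry F n b)"
  using res unfolding graded_free_resolution_def homogeneous_elt_hom_elt by (elim conjE) simp

lemma homogeneous_lift:
  assumes "v \<in> free_mod F n" "is_cycle n v" "hom_elt (bdeg F n) j v"
  shows "\<exists>w\<in>free_mod F (Suc n). hom_elt (bdeg F (Suc n)) j w \<and> dd n w = v"
proof -
  have "v \<in> dd n ` free_mod F (Suc n)" using assms(1,2) exact[of n] by simp
  then obtain w0 where w0: "w0 \<in> free_mod F (Suc n)" "dd n w0 = v" by auto
  let ?w = "elt_part (bdeg F (Suc n)) j w0"
  have "hom_elt (bdeg F n) (bdeg F (Suc n) b) (bdry F n b)" if "b \<in> keys w0" for b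
    using bdry_homogeneous[of b n] w0(1) that by (auto simp: free_mod_def)
  then have "dd n ?w = elt_part (bdeg F n) j v"
    using w0(2) lin_map_elt_part[of w0 "bdeg F n" "bdeg F (Suc n)" "bdry F n" j]
    by (simp add: bdry_map_lin_map)
  also have "\<dots> = v" using elt_part_hom_elt[OF assms(3)] by simp
  finally have "dd n ?w = v" .
  moreover have "?w \<in> free_mod F (Suc n)"
    using w0(1) keys_elt_part[of _ j w0] by (auto simp: free_mod_def)
  ultimately show ?thesis using hom_elt_elt_part by blast
qed

text \<open>
  The image, under the chain map \<open>b\<close>, of the Koszul boundary of the basis element \<open>A\<close>.
\<close>
definition koszul :: "(nat set \<Rightarrow> (nat \<Rightarrow>\<^sub>0 ('x, 'k) mpoly)) \<Rightarrow> nat set \<Rightarrow> (nat \<Rightarrow>\<^sub>0 ('x, 'k) mpoly)" where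
  "koszul b A = (\<Sum>a\<in>A. smul (koszul_sign A a * f a) (b (A - {a})))"

text \<open>
  The values of \<open>b\<close> are the images of the basis elements of the Koszul complex on the \<open>f a\<close> under a
  chain map to \<open>F\<close> that sends 1 to \<open>g\<close>.
\<close>
definition lifted :: "(nat set \<Rightarrow> (nat \<Rightarrow>\<^sub>0 ('x, 'k) mpoly)) \<Rightarrow> nat set \<Rightarrow> bool" where
  "lifted b A \<longleftrightarrow> b A \<in> free_mod F (card A) \<and>
     hom_elt (bdeg F (card A)) (h + 2 * int (card A)) (b A) \<and>
     (A = {} \<longrightarrow> lookup (b A) 0 = g) \<and> (\<forall>i. card A = Suc i \<longrightarrow> dd i (b A) = koszul b A)"

text \<open>
  The Koszul boundary squares to zero, so the image of the boundary of \<open>A\<close> is a cycle of the exact complex \<open>F\<close>;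
  for a single element \<open>a\<close> this is the assumption that \<open>f a * g\<close> lies in \<open>J\<close>.
\<close>
lemma koszul_liftable:
  assumes b: "\<And>A. A \<subseteq> {..<e} \<Longrightarrow> card A \<le> n \<Longrightarrow> lifted b A"
    and A: "A \<subseteq> {..<e}" "card A = Suc n"
  shows "\<exists>w\<in>free_mod F (Suc n). hom_elt (bdeg F (Suc n)) (h + 2 * int (Suc n)) w \<and> dd n w = koszul b A"
proof (rule homogeneous_lift)
  have fin: "finite A" using A(2) card.infinite by fastforce
  have sub: "lifted b (A - {a})" "card (A - {a}) = n" if "a \<in> A" for a
  proof -
    show "card (A - {a}) = n" using that A(2) fin by simp
    then show "lifted b (A - {a})" using b[of "A - {a}"] A(1) by auto
  qed
  show "koszul b A \<in> free_mod F n"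
    unfolding koszul_def
  proof (rule free_mod_sum)
    fix a assume "a \<in> A"
    then show "smul (koszul_sign A a * f a) (b (A - {a})) \<in> free_mod F n"
      using sub[of a] unfolding lifted_def by (metis free_mod_smul)
  qed
  show "hom_elt (bdeg F n) (h + 2 * int (Suc n)) (koszul b A)"
    unfolding koszul_def
  proof (rule hom_elt_sum)
    fix a assume a: "a \<in> A"
    have "homogeneous 0 (koszul_sign A a :: ('x, 'k) mpoly)"
      using homogeneous_const[of "1 :: 'k"] homogeneous_const[of "- 1 :: 'k"]
      by (auto simp: koszul_sign_def single_uminus minus_one_power_iff)
    then have "homogeneous (0 + 2) (koszul_sign A a * f a)"
      using f[of a] a A(1) by (intro homogeneous_mult) auto
    then show "hom_elt (bdeg F n) (h + 2 * int (Suc n)) (smul (koszul_sign A a * f a) (b (A - {a})))"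
      using sub[OF a] by (intro hom_elt_smul[of 2 _ _ "h + 2 * int n"]) (auto simp: lifted_def)
  qed
  show "is_cycle n (koszul b A)"
  proof (cases n)
    case 0
    then obtain a where "A = {a}" using A(2) by (metis One_nat_def card_1_singletonE)
    moreover have "lookup (b {}) 0 = g" using b[of "{}"] by (simp add: lifted_def)
    moreover have "f a * g \<in> J" using A(1) \<open>A = {a}\<close> by (intro gf) auto
    moreover have "koszul_sign {a} a = (1 :: ('x, 'k) mpoly)"
    proof -
      have e: "{c \<in> {a}. c < a} = {}" by auto
      show ?thesis unfolding koszul_sign_def e by simp
    qed
    ultimately show ?thesis using 0 by (simp add: is_cycle_def koszul_def)
  next
    case (Suc i)
    let ?T = "\<lambda>a c. smul (koszul_sign A a * f a * (koszul_sign (A - {a}) c * f c)) (b (A - {a} - {c}))"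
    have "dd i (koszul b A) = (\<Sum>a\<in>A. smul (koszul_sign A a * f a) (koszul b (A - {a})))"
      unfolding koszul_def[of b A] dd_sum dd_smul using sub Suc by (simp add: lifted_def)
    also have "\<dots> = (\<Sum>a\<in>A. \<Sum>c\<in>A - {a}. ?T a c)"
      by (simp add: koszul_def smul_sum smul_smul)
    also have "\<dots> = 0"
    proof (rule sum_antisym_zero[OF fin])
      fix a c assume ac: "a \<in> A" "c \<in> A" "a \<noteq> c"
      have "koszul_sign A a * f a * (koszul_sign (A - {a}) c * f c) = (koszul_sign A a * koszul_sign (A - {a}) c) * (f a * f c)"
        by (simp add: ac_simps)
      also have "\<dots> = - (koszul_sign A c * f c * (koszul_sign (A - {c}) a * f a))"
        unfolding koszul_sign_antisym[OF fin ac] by (simp add: ac_simps)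
      finally have "koszul_sign A a * f a * (koszul_sign (A - {a}) c * f c) = - (koszul_sign A c * f c * (koszul_sign (A - {c}) a * f a))" .
      moreover have "A - {a} - {c} = A - {c} - {a}" by blast
      ultimately show "?T a c = - ?T c a" by (simp only: smul_minus)
    qed
    finally show ?thesis using Suc by (simp add: is_cycle_def)
  qed
qed

lemma chain_map_exists: "\<exists>b. \<forall>A\<subseteq>{..<e}. lifted b A"
proof -
  have "\<exists>b. \<forall>A\<subseteq>{..<e}. card A \<le> n \<longrightarrow> lifted b A" for n
  proof (induction n)
    case 0
    have "lifted (\<lambda>_. single 0 g) {}"
      using g by (auto simp: lifted_def free_mod_def F0 hom_elt_def lookup_single when_def)
    moreover have "A = {}" if "A \<subseteq> {..<e}" "card A \<le> 0" for A
      using that finite_subset[of A "{..<e}"] by simp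
    ultimately show ?case by metis
  next
    case (Suc n)
    then obtain b where b: "\<And>A. A \<subseteq> {..<e} \<Longrightarrow> card A \<le> n \<Longrightarrow> lifted b A" by blast
    have "\<forall>A. \<exists>w. A \<subseteq> {..<e} \<and> card A = Suc n \<longrightarrow> w \<in> free_mod F (Suc n) \<and>
        hom_elt (bdeg F (Suc n)) (h + 2 * int (Suc n)) w \<and> dd n w = koszul b A"
      using koszul_liftable[OF b] by blast
    from choice[OF this] obtain w where w: "\<And>A. A \<subseteq> {..<e} \<Longrightarrow> card A = Suc n \<Longrightarrow>
        w A \<in> free_mod F (Suc n) \<and>
        hom_elt (bdeg F (Suc n)) (h + 2 * int (Suc n)) (w A) \<and> dd n (w A) = koszul b A"
      by blast
    define b' where "b' A = (if card A = Suc n then w A else b A)" for A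
    have koszul_eq: "koszul b' A = koszul b A" if "A \<subseteq> {..<e}" "card A \<le> Suc n" for A
      unfolding koszul_def
    proof (rule sum.cong[OF refl])
      fix a assume "a \<in> A"
      then have "card (A - {a}) < card A"
        using that(1) finite_subset[of A "{..<e}"] by (intro psubset_card_mono) auto
      then show "smul (koszul_sign A a * f a) (b' (A - {a})) = smul (koszul_sign A a * f a) (b (A - {a}))"
        using that(2) by (simp add: b'_def)
    qed
    have "lifted b' A" if A: "A \<subseteq> {..<e}" "card A \<le> Suc n" for A
    proof (cases "card A = Suc n")
      case True
      then show ?thesis using w[OF A(1) True] koszul_eq[OF A] by (auto simp: lifted_def b'_def)
    next
      case False
      then have "lifted b A" using b A by simp
      then show ?thesis using False koszul_eq[OF A] by (auto simp: lifted_def b'_def)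
    qed
    then show ?case by blast
  qed
  from this[of e] obtain b where b: "\<forall>A\<subseteq>{..<e}. card A \<le> e \<longrightarrow> lifted b A" by blast
  have "card A \<le> e" if "A \<subseteq> {..<e}" for A using card_mono[OF _ that] by simp
  then show ?thesis using b by blast
qed

lemma split_vector:
  assumes "j < e" "q \<in> free_mod F n" "\<And>x. lookup q x \<in> Q j"
  shows "\<exists>u\<in>free_mod F n. \<forall>x. lookup (q - smul (Y j) u) x \<in> Q (Suc j)"
proof -
  have "\<forall>x. \<exists>u. lookup q x - Y j * u \<in> Q (Suc j)" using Q_split assms by blast
  from choice[OF this] obtain u where u: "\<And>x. lookup q x - Y j * u x \<in> Q (Suc j)" by blast
  define v where "v = (\<Sum>x\<in>keys q. single x (u x))"
  have v: "lookup v x = (if x \<in> keys q then u x else 0)" for x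
    by (simp add: v_def lookup_sum lookup_single when_def)
  have "v \<in> free_mod F n" using assms(2) by (auto simp: free_mod_def in_keys_iff v split: if_splits)
  moreover have "lookup (q - smul (Y j) v) x \<in> Q (Suc j)" for x
    using u[of x] Q[of "Suc j"] by (auto simp: lookup_minus v in_keys_iff is_ideal_def)
  ultimately show ?thesis by blast
qed

text \<open>
  Write \<open>b\<^sub>j\<close> for the value at \<open>{j..<e}\<close> and suppose \<open>Y\<^sub>0 \<cdots> Y\<^sub>j\<^sub>-\<^sub>1 b\<^sub>j = dd w + q\<close> with \<open>q\<close> in \<open>Q j\<close>. Split
  \<open>q = Y\<^sub>j u + q'\<close> with \<open>q'\<close> in \<open>Q (j + 1)\<close> and apply the boundary map. Modulo \<open>Q (j + 1)\<close> only the summand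
  of \<open>f j\<close>, which is congruent to \<open>Y\<^sub>j\<^sup>2\<close>, survives in the Koszul boundary on the left, so
  \<open>Y\<^sub>j (Y\<^sub>0 \<cdots> Y\<^sub>j b\<^sub>j\<^sub>+\<^sub>1 - dd u)\<close> lies in \<open>Q (j + 1)\<close>, and \<open>Y\<^sub>j\<close> can be cancelled.
\<close>
lemma climb:
  assumes b: "\<And>A. A \<subseteq> {..<e} \<Longrightarrow> lifted b A"
    and v: "b {..<e} \<in> tensor_boundaries F e"
    and "j \<le> e"
  shows "\<exists>w\<in>free_mod F (Suc (e - j)). \<exists>q. (\<forall>x. lookup q x \<in> Q j) \<and>
     smul (\<Prod>i<j. Y i) (b {j..<e}) = dd (e - j) w + q"
  using \<open>j \<le> e\<close>
proof (induction j)
  case 0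
  obtain w u where "b {..<e} = dd e w + u" "w \<in> free_mod F (Suc e)" "u \<in> irrelevant_submod F e"
    using v unfolding tensor_boundaries_def by blast
  then show ?case using Q0 by (auto simp: irrelevant_submod_def atLeast0LessThan)
next
  case (Suc j)
  define i where "i = e - Suc j"
  have j: "j < e" "e - j = Suc i" using Suc.prems by (auto simp: i_def)
  define P where "P = (\<Prod>i<j. Y i)"
  obtain w q where wq: "w \<in> free_mod F (Suc (Suc i))" "\<And>x. lookup q x \<in> Q j"
      "smul P (b {j..<e}) = dd (Suc i) w + q"
    using Suc j unfolding P_def by auto
  have sub: "{l..<e} \<subseteq> {..<e}" for l by auto
  have bj: "b {j..<e} \<in> free_mod F (Suc i)" "dd i (b {j..<e}) = koszul b {j..<e}"
    using b[OF sub[of j]] j by (auto simp: lifted_def)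
  have bs: "b {Suc j..<e} \<in> free_mod F i"
    using b[OF sub[of "Suc j"]] by (auto simp: lifted_def i_def)
  have qf: "q \<in> free_mod F (Suc i)"
  proof -
    have "q = smul P (b {j..<e}) - dd (Suc i) w" using wq(3) by simp
    then show ?thesis using bj wq(1) by (simp add: free_mod_diff free_mod_smul dd_free)
  qed
  obtain u where u: "u \<in> free_mod F (Suc i)" "\<And>x. lookup (q - smul (Y j) u) x \<in> Q (Suc j)"
    using split_vector[OF j(1) qf wq(2)] by blast
  let ?q' = "q - smul (Y j) u"
  let ?z = "smul (\<Prod>i<Suc j. Y i) (b {Suc j..<e}) - dd i u"
  define r where "r = (\<Sum>a\<in>{Suc j..<e}. smul (koszul_sign {j..<e} a * f a) (b ({j..<e} - {a})))"
  have rQ: "lookup r x \<in> Q (Suc j)" for x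
    unfolding r_def lookup_sum lookup_smul
    by (intro is_ideal_sum[OF Q] is_ideal_mult_right[OF Q] is_ideal_mult_left[OF Q] Q_later) auto
  have "{j..<e} = insert j {Suc j..<e}" using j by auto
  moreover have "{j..<e} - {j} = {Suc j..<e}" by auto
  moreover have "koszul_sign {j..<e} j = (1 :: ('x, 'k) mpoly)"
  proof -
    have e: "{c \<in> {j..<e}. c < j} = {}" by auto
    show ?thesis unfolding koszul_sign_def e by simp
  qed
  ultimately have koszul: "koszul b {j..<e} = smul (f j) (b {Suc j..<e}) + r"
    unfolding koszul_def r_def by (subst (2) \<open>{j..<e} = insert j {Suc j..<e}\<close>) simp
  have "dd i (dd (Suc i) w) = 0" using dd_is_cycle[OF wq(1)] by (simp add: is_cycle_def)
  then have "dd i (smul P (b {j..<e})) = dd i q" by (simp add: wq(3) dd_add)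
  also have "dd i q = smul (Y j) (dd i u) + dd i ?q'" by (simp add: dd_diff dd_smul)
  finally have eq: "smul P (smul (f j) (b {Suc j..<e}) + r) = smul (Y j) (dd i u) + dd i ?q'"
    by (simp add: dd_smul bj(2) koszul)
  have "Y j * lookup ?z x \<in> Q (Suc j)" for x
  proof -
    let ?B = "lookup (b {Suc j..<e}) x"
    have "P * (f j * ?B + lookup r x) = Y j * lookup (dd i u) x + lookup (dd i ?q') x"
      using arg_cong[OF eq, of "\<lambda>v. lookup v x"] by (simp add: lookup_add)
    then have "Y j * lookup ?z x =
        lookup (dd i ?q') x - P * lookup r x - (f j - Y j * Y j) * (P * ?B)"
      by (simp add: lookup_minus P_def[symmetric] algebra_simps)
    also have "\<dots> \<in> Q (Suc j)"
    proof (intro is_ideal_diff[OF Q])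
      show "lookup (dd i ?q') x \<in> Q (Suc j)"
        unfolding bdry_map_lin_map using Q u(2) by (rule lin_map_in_ideal)
      show "P * lookup r x \<in> Q (Suc j)" using rQ Q by (simp add: is_ideal_def)
      show "(f j - Y j * Y j) * (P * ?B) \<in> Q (Suc j)"
        using Q_diag[OF j(1)] by (rule is_ideal_mult_right[OF Q])
    qed
    finally show ?thesis .
  qed
  then have "lookup ?z x \<in> Q (Suc j)" for x using Q_cancel[OF j(1)] by blast
  moreover have "smul (\<Prod>i<Suc j. Y i) (b {Suc j..<e}) = dd (e - Suc j) u + ?z"
    by (simp add: i_def)
  moreover have "u \<in> free_mod F (Suc (e - Suc j))" using u(1) by (simp add: i_def)
  ultimately show ?case by blast
qed

text \<open>
  Otherwise the descent ends with \<open>Y\<^sub>0 \<cdots> Y\<^sub>e\<^sub>-\<^sub>1 g\<close> in \<open>J + Q e\<close>.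
\<close>
lemma Tor_nonzero: "Tor_nonzero J e (h + 2 * int e)"
proof -
  obtain b where b: "\<And>A. A \<subseteq> {..<e} \<Longrightarrow> lifted b A" using chain_map_exists by blast
  let ?v = "b {..<e}"
  have v: "?v \<in> free_mod F e" "hom_elt (bdeg F e) (h + 2 * int e) ?v"
    using b[of "{..<e}"] by (auto simp: lifted_def)
  have irr: "f a \<in> irrelevant_ideal" if "a < e" for a
  proof -
    have "0 \<notin> keys (f a)" using f[OF that] by (auto simp: homogeneous_def mon_degree_def)
    then show ?thesis by (simp add: irrelevant_ideal_def in_keys_iff)
  qed
  have "?v \<in> tensor_cycles F e"
  proof (cases e)
    case 0
    then show ?thesis using v by (simp add: tensor_cycles_def)
  next
    case (Suc i)
    have "dd i ?v = koszul b {..<e}" using b[of "{..<e}"] Suc by (simp add: lifted_def)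
    moreover have "lookup (koszul b {..<e}) x \<in> irrelevant_ideal" for x
      unfolding koszul_def lookup_sum lookup_smul
      by (intro is_ideal_sum is_ideal_mult_right is_ideal_mult_left is_ideal_irrelevant irr) auto
    ultimately show ?thesis
      using v(1) dd_free[of ?v i] Suc by (simp add: tensor_cycles_def irrelevant_submod_def)
  qed
  moreover have "?v \<notin> tensor_boundaries F e"
  proof
    assume "?v \<in> tensor_boundaries F e"
    from climb[OF b this, of e] obtain w q where wq: "w \<in> free_mod F (Suc 0)"
        "\<And>x. lookup q x \<in> Q e" "smul (\<Prod>i<e. Y i) (b {}) = dd 0 w + q"
      by auto
    have "lookup (b {}) 0 = g" using b[of "{}"] by (simp add: lifted_def)
    then have "(\<Prod>i<e. Y i) * g - lookup q 0 = lookup (dd 0 w) 0"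
      using arg_cong[OF wq(3), of "\<lambda>v. lookup v 0"] by (simp add: lookup_add)
    moreover have "lookup (dd 0 w) 0 \<in> J" using dd_is_cycle[OF wq(1)] by (simp add: is_cycle_def)
    ultimately show False using notin[OF wq(2)[of 0]] by simp
  qed
  ultimately show ?thesis
    unfolding Tor_nonzero_def using res v(2) by (auto simp: homogeneous_elt_hom_elt)
qed

end

section \<open>Specialising the LSS-ideal along a coloured subgraph\<close>

lemma lookup_Var_mult: "lookup (Var x * p) (m + single x 1) = lookup p m"
proof -
  have "Var x * p = Var x * (\<Sum>n\<in>keys p. single n (lookup p n))" by (simp add: sum_single_lookup)
  also have "\<dots> = (\<Sum>n\<in>keys p. single (n + single x 1) (lookup p n))"
    by (simp add: sum_distrib_left Var_def mult_single add.commute)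
  finally have "lookup (Var x * p) (m + single x 1) =
      (\<Sum>n\<in>keys p. if n = m then lookup p n else 0)"
    by (simp add: lookup_sum lookup_single when_def)
  also have "\<dots> = lookup p m" by (simp add: in_keys_iff)
  finally show ?thesis .
qed

text \<open>
  The ideal generated by the variables in \<open>X\<close>, described by its monomials.
\<close>
definition Var_ideal :: "'x set \<Rightarrow> ('x, 'k::field) mpoly set" where
  "Var_ideal X = {p. \<forall>m\<in>keys p. \<exists>x\<in>X. lookup m x \<noteq> 0}"

lemma is_ideal_Var_ideal: "is_ideal (Var_ideal X)"
  unfolding is_ideal_def
proof (intro conjI ballI allI)
  show "0 \<in> Var_ideal X" by (simp add: Var_ideal_def)
next
  fix p q :: "('a, 'b) mpoly" assume "p \<in> Var_ideal X" "q \<in> Var_ideal X"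
  then show "p + q \<in> Var_ideal X" using keys_add[of p q] unfolding Var_ideal_def by blast
next
  fix c p :: "('a, 'b) mpoly" assume p: "p \<in> Var_ideal X"
  show "c * p \<in> Var_ideal X"
    unfolding Var_ideal_def
  proof (intro CollectI ballI)
    fix m assume "m \<in> keys (c * p)"
    then obtain a b where "m = a + b" "b \<in> keys p" using keys_mult by blast
    then show "\<exists>x\<in>X. lookup m x \<noteq> 0" using p by (auto simp: Var_ideal_def lookup_add)
  qed
qed

lemma Var_in_Var_ideal: "x \<in> X \<Longrightarrow> Var x \<in> Var_ideal X"
  by (auto simp: Var_ideal_def Var_def intro!: bexI[of _ x])

lemma Var_ideal_mono: "X \<subseteq> X' \<Longrightarrow> Var_ideal X \<subseteq> Var_ideal X'"
  unfolding Var_ideal_def by blast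

lemma Var_ideal_cancel:
  assumes "Var x * p \<in> Var_ideal X" "x \<notin> X"
  shows "p \<in> Var_ideal X"
  unfolding Var_ideal_def
proof (intro CollectI ballI)
  fix m assume "m \<in> keys p"
  then have "m + single x 1 \<in> keys (Var x * p)" by (simp only: in_keys_iff lookup_Var_mult not_False_eq_True)
  then obtain y where "y \<in> X" "lookup (m + single x 1) y \<noteq> 0" using assms(1) unfolding Var_ideal_def by blast
  then show "\<exists>y\<in>X. lookup m y \<noteq> 0" using assms(2)
    by (intro bexI[of _ y]) (auto simp: lookup_add lookup_single when_def split: if_splits)
qed

lemma Var_ideal_split:
  assumes "p \<in> Var_ideal (insert x X)"
  shows "\<exists>u. p - Var x * u \<in> Var_ideal X"
proof -
  define M where "M = {m \<in> keys p. lookup m x \<noteq> 0}"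
  define u where "u = (\<Sum>m\<in>M. single (m - single x 1) (lookup p m))"
  have "Var x * u = (\<Sum>m\<in>M. single m (lookup p m))"
    unfolding u_def sum_distrib_left
  proof (rule sum.cong[OF refl])
    fix m assume "m \<in> M"
    then have "single x 1 + (m - single x 1) = m"
      by (intro poly_mapping_eqI) (auto simp: M_def lookup_add lookup_minus lookup_single when_def)
    then show "Var x * single (m - single x 1) (lookup p m) = single m (lookup p m)"
      by (simp add: Var_def mult_single)
  qed
  then have l: "lookup (p - Var x * u) n = (if n \<in> M then 0 else lookup p n)" for n
    by (simp add: lookup_minus lookup_sum lookup_single when_def M_def)
  have "p - Var x * u \<in> Var_ideal X"
    unfolding Var_ideal_def
  proof (intro CollectI ballI)
    fix n assume "n \<in> keys (p - Var x * u)"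
    then have "n \<in> keys p" "n \<notin> M" unfolding in_keys_iff l by (auto split: if_splits)
    then show "\<exists>y\<in>X. lookup n y \<noteq> 0" using assms by (auto simp: Var_ideal_def M_def)
  qed
  then show ?thesis by blast
qed

lemma homogeneous_lss_form:
  "homogeneous 2 (lss_form i j :: ('v::finite \<times> 'd::finite, 'k::field) mpoly)"
  unfolding lss_form_def
  by (rule homogeneous_sum) (use homogeneous_mult[OF homogeneous_Var homogeneous_Var] in simp)

lemma graded_ideal_LSS: "graded_ideal (LSS_ideal E :: ('v::finite \<times> 'd::finite, 'k::field) mpoly set)"
  unfolding LSS_ideal_def
proof (rule graded_ideal_gen)
  fix a :: "('v \<times> 'd, 'k) mpoly" and d
  assume a: "a \<in> {lss_form i j |i j. {i, j} \<in> E}"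
  then have "homogeneous 2 a" using homogeneous_lss_form by blast
  then have "degree_part d a = (if d = 2 then a else 0)" by (rule degree_part_homogeneous)
  then show "degree_part d a \<in> ideal_gen {lss_form i j |i j. {i, j} \<in> E}"
    using a by (simp add: ideal_gen_base ideal_gen_zero)
qed

text \<open>
  The functions \<open>p\<close> and \<open>q\<close> pick the two ends of an edge, and \<open>hs\<close> lists the edges of \<open>H\<close> by decreasing
  weight. The parameter \<open>field_type\<close> carries the type of the coefficients.
\<close>
locale coloured_induced_subgraph =
  fixes E :: "'v::finite set set" and W :: "'v set" and H :: "'v set set"
    and c :: "'v set \<Rightarrow> 'd::finite" and w :: "'v set \<Rightarrow> nat"
    and p q :: "'v set \<Rightarrow> 'v" and hs :: "nat \<Rightarrow> 'v set" and field_type :: "'k::field itself"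
  assumes H_def: "H = induced_edges E W"
    and ends: "\<And>h. h \<in> H \<Longrightarrow> h = {p h, q h} \<and> p h \<noteq> q h"
    and col: "concave_colouring H c w"
    and hs: "bij_betw hs {..<card H} H"
    and sorted: "\<And>a b. a \<le> b \<Longrightarrow> b < card H \<Longrightarrow> w (hs b) \<le> w (hs a)"
begin

definition edge :: "'v \<times> 'd \<Rightarrow> 'v set" where
  "edge x = (SOME h. h \<in> H \<and> fst x \<in> h \<and> c h = snd x)"

definition seen :: "'v \<times> 'd \<Rightarrow> bool" where
  "seen x \<longleftrightarrow> (\<exists>h\<in>H. fst x \<in> h \<and> c h = snd x)"

text \<open>
  The variable that serves as \<open>y\<^sub>h\<close>. Taking it among the variables of \<open>S\<close> makes the specialisation
  an idempotent endomorphism of \<open>S\<close>.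
\<close>
definition edge_var :: "'v set \<Rightarrow> 'v \<times> 'd" where
  "edge_var h = (p h, c h)"

definition spec :: "'v \<times> 'd \<Rightarrow> ('v \<times> 'd, 'k) mpoly" where
  "spec x = (if seen x then Var (edge_var (edge x)) else 0)"

lemma ends_in: "h \<in> H \<Longrightarrow> p h \<in> h" "h \<in> H \<Longrightarrow> q h \<in> h"
  using ends by blast+

lemma edge: "seen x \<Longrightarrow> edge x \<in> H \<and> fst x \<in> edge x \<and> c (edge x) = snd x"
  unfolding seen_def edge_def by (rule someI_ex) blast

lemma edge_eq:
  assumes "h \<in> H" "v \<in> h"
  shows "edge (v, c h) = h" "seen (v, c h)"
proof -
  show s: "seen (v, c h)" using assms by (auto simp: seen_def)
  show "edge (v, c h) = h"
    using edge[OF s] assms col unfolding concave_colouring_def by (metis IntI empty_iff fst_conv snd_conv)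
qed

lemma spec_edge: "h \<in> H \<Longrightarrow> v \<in> h \<Longrightarrow> spec (v, c h) = Var (edge_var h)"
  by (simp add: spec_def edge_eq)

lemma edge_of_edge_var: "h \<in> H \<Longrightarrow> edge (edge_var h) = h"
  using ends_in[of h] edge_eq[of h "p h"] by (simp add: edge_var_def)

lemma spec_edge_var: "h \<in> H \<Longrightarrow> spec (edge_var h) = Var (edge_var h)"
  using ends_in[of h] spec_edge[of h "p h"] by (simp add: edge_var_def)

lemma inj_edge_var: "inj_on edge_var H"
  using edge_of_edge_var by (metis inj_onI)

lemma subst_spec_idem: "subst spec (subst spec r) = subst spec r"
proof (induction r rule: mpoly_induct)
  case (Var x)
  then show ?case using edge[of x] spec_edge_var[of "edge x"] by (auto simp: spec_def)
qed (simp_all add: subst_add subst_mult)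

lemma subst_lss_form: "subst spec (lss_form i j) = (\<Sum>l\<in>UNIV. spec (i, l) * spec (j, l))"
  by (simp add: lss_form_def subst_sum subst_mult)

text \<open>
  The colours, other than that of \<open>h\<close>, which contribute a term to the specialised quadric of \<open>h\<close>.
\<close>
definition both :: "'v set \<Rightarrow> 'd set" where
  "both h = {l. l \<noteq> c h \<and> seen (p h, l) \<and> seen (q h, l)}"

lemma subst_form_edge:
  assumes h: "h \<in> H"
  shows "subst spec (lss_form (p h) (q h)) =
    Var (edge_var h) ^ 2 + (\<Sum>l\<in>both h. Var (edge_var (edge (p h, l))) * Var (edge_var (edge (q h, l))))"
proof -
  have "(\<Sum>l\<in>UNIV. spec (p h, l) * spec (q h, l)) =
      spec (p h, c h) * spec (q h, c h) + (\<Sum>l\<in>UNIV - {c h}. spec (p h, l) * spec (q h, l))"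
    by (rule sum.remove) auto
  also have "spec (p h, c h) * spec (q h, c h) = Var (edge_var h) ^ 2"
    using spec_edge[OF h] ends_in[OF h] by (simp add: power2_eq_square)
  also have "(\<Sum>l\<in>UNIV - {c h}. spec (p h, l) * spec (q h, l)) = (\<Sum>l\<in>both h. spec (p h, l) * spec (q h, l))"
    by (rule sum.mono_neutral_right) (auto simp: both_def spec_def)
  also have "\<dots> = (\<Sum>l\<in>both h. Var (edge_var (edge (p h, l))) * Var (edge_var (edge (q h, l))))"
    by (rule sum.cong) (auto simp: both_def spec_def)
  finally show ?thesis by (simp add: subst_lss_form)
qed

lemma both_edges:
  assumes "h \<in> H" "l \<in> both h"
  shows "edge (p h, l) \<in> H" "edge (q h, l) \<in> H" "w (edge (p h, l)) + w (edge (q h, l)) < 2 * w h"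
proof -
  let ?e1 = "edge (p h, l)" and ?e2 = "edge (q h, l)"
  have e: "?e1 \<in> H" "p h \<in> ?e1" "c ?e1 = l" "?e2 \<in> H" "q h \<in> ?e2" "c ?e2 = l" "l \<noteq> c h"
    using edge[of "(p h, l)"] edge[of "(q h, l)"] assms(2) by (auto simp: both_def)
  have h: "{p h, q h} = h" using ends[OF assms(1)] by simp
  have ne: "?e1 \<noteq> h" "?e2 \<noteq> h" using e by auto
  note conc = conjunct2[OF col[unfolded concave_colouring_def], rule_format]
  from conc[of "p h" "q h" ?e1 ?e2] show "w ?e1 + w ?e2 < 2 * w h"
    using e ne assms(1) by (simp add: h)
  show "?e1 \<in> H" "?e2 \<in> H" using e by blast+
qed

text \<open>
  Variables that stand for no edge get their plain square, so that there is one quadric for each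
  variable.
\<close>
definition F :: "'v \<times> 'd \<Rightarrow> ('v \<times> 'd, 'k) mpoly" where
  "F x = (if x \<in> edge_var ` H then subst spec (lss_form (p (edge x)) (q (edge x))) else Var x ^ 2)"

lemma F_edge_var: "h \<in> H \<Longrightarrow> F (edge_var h) = subst spec (lss_form (p h) (q h))"
  by (simp add: F_def edge_of_edge_var)

lemma triangular:
  "triangular_quadrics (\<lambda>x. w (edge x)) (\<lambda>x. if x \<in> edge_var ` H then both (edge x) else {})
    (\<lambda>x l. edge_var (edge (p (edge x), l))) (\<lambda>x l. edge_var (edge (q (edge x), l))) F"
proof
  fix x
  show "F x = Var x ^ 2 + (\<Sum>l\<in>(if x \<in> edge_var ` H then both (edge x) else {}).
      Var (edge_var (edge (p (edge x), l))) * Var (edge_var (edge (q (edge x), l))))"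
    by (cases "x \<in> edge_var ` H") (auto simp: F_edge_var edge_of_edge_var subst_form_edge, simp add: F_def)
next
  fix x l assume l: "l \<in> (if x \<in> edge_var ` H then both (edge x) else {})"
  then have "x \<in> edge_var ` H" by (auto split: if_splits)
  then obtain h where h: "h \<in> H" "x = edge_var h" by blast
  then show "w (edge (edge_var (edge (p (edge x), l)))) + w (edge (edge_var (edge (q (edge x), l)))) < 2 * w (edge x)"
    using l both_edges[of h l] by (simp add: edge_of_edge_var)
qed

lemma lss_form_commute: "lss_form i j = lss_form j i"
  by (simp add: lss_form_def mult.commute)

text \<open>
  An edge outside \<open>H\<close> has an end outside \<open>W\<close>, and all variables of that end are sent to 0.
\<close>
lemma subst_LSS_ideal:
  assumes "r \<in> LSS_ideal E"
  shows "subst spec r \<in> ideal_gen (range F)"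
  using assms unfolding LSS_ideal_def
proof (rule subst_ideal_gen[rotated])
  fix a :: "('v \<times> 'd, 'k) mpoly" assume "a \<in> {lss_form i j |i j. {i, j} \<in> E}"
  then obtain i j where ij: "a = lss_form i j" "{i, j} \<in> E" by blast
  show "subst spec a \<in> ideal_gen (range F)"
  proof (cases "{i, j} \<in> H")
    case True
    then have "{i, j} = {p {i, j}, q {i, j}}" using ends by blast
    then have "a = lss_form (p {i, j}) (q {i, j})"
      using ij(1) lss_form_commute by (metis doubleton_eq_iff)
    then have "subst spec a = F (edge_var {i, j})" using F_edge_var[OF True] by simp
    then show ?thesis by (simp add: ideal_gen_base)
  next
    case False
    have "\<not> seen (i, l) \<or> \<not> seen (j, l)" for l
    proof -
      have "v \<in> W" if "seen (v, l)" for v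
        using edge[OF that] by (auto simp: H_def induced_edges_def)
      moreover have "i \<notin> W \<or> j \<notin> W" using False ij(2) by (auto simp: H_def induced_edges_def)
      ultimately show ?thesis by blast
    qed
    then have "spec (i, l) * spec (j, l) = 0" for l by (auto simp: spec_def)
    then show ?thesis by (simp add: ij(1) subst_lss_form ideal_gen_zero)
  qed
qed

definition later :: "nat \<Rightarrow> ('v \<times> 'd) set" where
  "later j = (\<lambda>a. edge_var (hs a)) ` {j..<card H}"

definition Q :: "nat \<Rightarrow> ('v \<times> 'd, 'k) mpoly set" where
  "Q j = {r. subst spec r \<in> Var_ideal (later j)}"

lemma hs_in: "a < card H \<Longrightarrow> hs a \<in> H"
  using hs by (auto simp: bij_betw_def)

lemma later_Suc: "j < card H \<Longrightarrow> later j = insert (edge_var (hs j)) (later (Suc j))"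
proof -
  assume "j < card H"
  then have "{j..<card H} = insert j {Suc j..<card H}" by auto
  then show ?thesis by (simp add: later_def)
qed

lemma edge_var_hs_notin_later: "j < card H \<Longrightarrow> edge_var (hs j) \<notin> later (Suc j)"
proof
  assume j: "j < card H" and "edge_var (hs j) \<in> later (Suc j)"
  then obtain a where a: "Suc j \<le> a" "a < card H" "edge_var (hs j) = edge_var (hs a)" by (auto simp: later_def)
  then have "hs j = hs a" using inj_onD[OF inj_edge_var] hs_in j by blast
  then show False using a j hs by (auto simp: bij_betw_def dest: inj_onD)
qed

lemma is_ideal_Q: "is_ideal (Q j)"
  using is_ideal_Var_ideal[of "later j"] unfolding is_ideal_def Q_def
  by (auto simp: subst_add subst_mult)

lemma later_antimono: "j \<le> i \<Longrightarrow> later i \<subseteq> later j"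
  unfolding later_def by auto

text \<open>
  A product of two variables whose edges have mean weight below that of \<open>hs j\<close> contains
  a lighter and hence a later one.
\<close>
lemma lighter_later:
  assumes "j < card H" "h \<in> H" "w h < w (hs j)"
  shows "edge_var h \<in> later (Suc j)"
proof -
  obtain a where a: "a < card H" "h = hs a" using hs assms(2) by (auto simp: bij_betw_def)
  then have "j < a" using sorted[of a j] assms by (metis not_le)
  then show ?thesis using a by (auto simp: later_def)
qed

lemma subst_form_diag:
  assumes "j < card H"
  shows "subst spec (lss_form (p (hs j)) (q (hs j))) - Var (edge_var (hs j)) ^ 2 \<in> Var_ideal (later (Suc j))"
proof -
  have "(Var (edge_var (edge (p (hs j), l))) * Var (edge_var (edge (q (hs j), l))) :: ('v \<times> 'd, 'k) mpoly)
      \<in> Var_ideal (later (Suc j))" if "l \<in> both (hs j)" for l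
  proof -
    note b = both_edges[OF hs_in[OF assms] that]
    have "w (edge (p (hs j), l)) < w (hs j) \<or> w (edge (q (hs j), l)) < w (hs j)" using b(3) by linarith
    then show ?thesis
      using lighter_later[OF assms b(1)] lighter_later[OF assms b(2)] Var_in_Var_ideal
        is_ideal_mult_right[OF is_ideal_Var_ideal] is_ideal_mult_left[OF is_ideal_Var_ideal] by metis
  qed
  then show ?thesis
    unfolding subst_form_edge[OF hs_in[OF assms]] by (simp add: is_ideal_sum is_ideal_Var_ideal)
qed

lemma Tor_nonzero_LSS:
  assumes s: "s \<ge> 1" "0 < card H \<or> s = 1"
  shows "Tor_nonzero (ideal_power (LSS_ideal E :: ('v \<times> 'd, 'k) mpoly set) s) (card H)
    (int (2 * (s - 1)) + 2 * int (card H))"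
proof -
  let ?J = "ideal_power (LSS_ideal E :: ('v \<times> 'd, 'k) mpoly set) s"
  let ?e = "card H"
  define f where "f a = (lss_form (p (hs a)) (q (hs a)) :: ('v \<times> 'd, 'k) mpoly)" for a
  define Y where "Y a = (Var (edge_var (hs a)) :: ('v \<times> 'd, 'k) mpoly)" for a
  define g where "g = f 0 ^ (s - 1)"
  have sY: "subst spec (Y a) = Y a" if "a < ?e" for a using spec_edge_var[OF hs_in[OF that]] by (simp add: Y_def)
  have fL: "f a \<in> LSS_ideal E" if "a < ?e" for a
  proof -
    have "hs a \<in> E" using hs_in[OF that] by (simp add: H_def induced_edges_def)
    then have "{p (hs a), q (hs a)} \<in> E" using ends[OF hs_in[OF that]] by simp
    then show ?thesis unfolding f_def LSS_ideal_def by (intro ideal_gen_base) blast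
  qed
  have "graded_ideal ?J" by (intro graded_ideal_power graded_ideal_LSS)
  then obtain R where R: "graded_free_resolution ?J R" "basis R 0 = {0}" "bdeg R 0 = (\<lambda>_. 0)" "aug R = (\<lambda>_. 1)"
    using graded_free_resolution_exists[OF is_ideal_ideal_power] by metis
  have "flag_setup ?J R f Y Q g ?e (int (2 * (s - 1)))"
  proof
    show "is_ideal ?J" by (rule is_ideal_ideal_power)
    show "graded_free_resolution ?J R" "basis R 0 = {0}" "bdeg R 0 = (\<lambda>_. 0)" "aug R = (\<lambda>_. 1)"
      by fact+
    have "homogeneous (int (2 * n)) (f 0 ^ n)" for n
    proof (induction n)
      case 0
      then show ?case by (simp add: homogeneous_one)
    next
      case (Suc n)
      have "homogeneous (2 + int (2 * n)) (f 0 * f 0 ^ n)"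
        unfolding f_def by (intro homogeneous_mult homogeneous_lss_form Suc[unfolded f_def])
      then show ?case by (simp add: add.commute)
    qed
    then show "homogeneous (int (2 * (s - 1))) g" unfolding g_def .
    show "homogeneous 2 (f a)" for a unfolding f_def by (rule homogeneous_lss_form)
    show "f a * g \<in> ?J" if a: "a < ?e" for a
    proof -
      have "g \<in> ideal_power (LSS_ideal E) (s - 1)"
        unfolding g_def using fL[of 0] a by (intro power_in_ideal_power) auto
      then have "f a * g \<in> ideal_power (LSS_ideal E) (Suc (s - 1))"
        unfolding ideal_power.simps using fL[OF a] by (intro ideal_gen_base) blast
      then show ?thesis using s(1) by simp
    qed
    show "is_ideal (Q j)" for j by (rule is_ideal_Q)
    show "irrelevant_ideal \<subseteq> Q 0"
    proof
      fix r :: "('v \<times> 'd, 'k) mpoly" assume r: "r \<in> irrelevant_ideal"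
      have "spec x \<in> Var_ideal (later 0)" for x
      proof (cases "seen x")
        case True
        have "edge x \<in> hs ` {..<?e}" using hs edge[OF True] by (simp add: bij_betw_def)
        then have "edge_var (edge x) \<in> later 0" by (auto simp: later_def)
        then show ?thesis using True by (simp add: spec_def Var_in_Var_ideal)
      next
        case False
        then show ?thesis by (simp add: spec_def Var_ideal_def)
      qed
      moreover have "\<exists>x. lookup m x \<noteq> 0" if "m \<in> keys r" for m
      proof -
        have "m \<noteq> 0" using r that by (auto simp: irrelevant_ideal_def)
        then show ?thesis by (metis poly_mapping_eqI lookup_zero)
      qed
      ultimately have "subst spec r \<in> Var_ideal (later 0)"
        by (intro subst_in_ideal is_ideal_Var_ideal) blast
      then show "r \<in> Q 0" by (simp add: Q_def)
    qed
  next
    fix j r assume j: "j < ?e" and r: "r \<in> Q j"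
    then have "subst spec r \<in> Var_ideal (insert (edge_var (hs j)) (later (Suc j)))"
      by (simp add: Q_def later_Suc)
    from Var_ideal_split[OF this] obtain u where u: "subst spec r - Y j * u \<in> Var_ideal (later (Suc j))"
      unfolding Y_def by (elim exE)
    have "subst spec (subst spec r - Y j * u) \<in> Var_ideal (later (Suc j))"
    proof (rule subst_in_ideal[OF is_ideal_Var_ideal])
      fix m assume "m \<in> keys (subst spec r - Y j * u)"
      then obtain x where x: "x \<in> later (Suc j)" "lookup m x \<noteq> 0" using u unfolding Var_ideal_def by blast
      then obtain a where "a < ?e" "x = edge_var (hs a)" by (auto simp: later_def)
      then have "spec x \<in> Var_ideal (later (Suc j))" using spec_edge_var[OF hs_in] x(1) by (simp add: Var_in_Var_ideal)
      then show "\<exists>x. lookup m x \<noteq> 0 \<and> spec x \<in> Var_ideal (later (Suc j))" using x(2) by blast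
    qed
    then show "\<exists>u. r - Y j * u \<in> Q (Suc j)"
      using sY[OF j] by (auto simp: Q_def subst_diff subst_mult subst_spec_idem)
  next
    fix j r assume j: "j < ?e" and r: "Y j * r \<in> Q (Suc j)"
    then have "Y j * subst spec r \<in> Var_ideal (later (Suc j))" using sY[OF j] by (simp add: Q_def subst_mult)
    then show "r \<in> Q (Suc j)"
      using Var_ideal_cancel[OF _ edge_var_hs_notin_later[OF j]] by (simp add: Q_def Y_def)
  next
    fix j assume j: "j < ?e"
    have "subst spec (f j - Y j * Y j) = subst spec (f j) - Y j ^ 2"
      using sY[OF j] by (simp add: subst_diff subst_mult power2_eq_square)
    then show "f j - Y j * Y j \<in> Q (Suc j)"
      using subst_form_diag[OF j] by (simp add: Q_def f_def Y_def)
  next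
    fix j a assume ja: "j < a" "a < ?e"
    have "subst spec (f a) - Y a ^ 2 \<in> Var_ideal (later (Suc j))"
      using subst_form_diag[OF ja(2)] Var_ideal_mono[OF later_antimono[of "Suc j" "Suc a"]] ja(1)
      unfolding f_def Y_def by auto
    moreover have "Y a \<in> Var_ideal (later (Suc j))"
      unfolding Y_def using ja by (intro Var_in_Var_ideal) (auto simp: later_def)
    then have "Y a ^ 2 \<in> Var_ideal (later (Suc j))"
      unfolding power2_eq_square by (intro is_ideal_mult_left is_ideal_Var_ideal)
    ultimately have "(subst spec (f a) - Y a ^ 2) + Y a ^ 2 \<in> Var_ideal (later (Suc j))"
      using is_ideal_Var_ideal[of "later (Suc j)"] unfolding is_ideal_def by blast
    then show "f a \<in> Q (Suc j)" by (simp add: Q_def)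
  next
    fix r assume r: "r \<in> Q ?e"
    have "later ?e = {}" by (simp add: later_def)
    then have r0: "subst spec r = 0"
      using r unfolding Q_def Var_ideal_def by (auto intro!: poly_mapping_eqI simp: in_keys_iff)
    show "(\<Prod>j<?e. Y j) * g - r \<notin> ?J"
    proof
      assume "(\<Prod>j<?e. Y j) * g - r \<in> ?J"
      then have "subst spec ((\<Prod>j<?e. Y j) * g - r) \<in> ideal_power (ideal_gen (range F)) s"
        by (rule subst_ideal_power[rotated]) (rule subst_LSS_ideal)
      moreover have "subst spec (\<Prod>j<?e. Y j) = (\<Prod>x\<in>edge_var ` H. Var x)"
      proof -
        have "(\<Prod>x\<in>edge_var ` H. Var x :: ('v \<times> 'd, 'k) mpoly) = (\<Prod>h\<in>H. Var (edge_var h))"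
          using inj_edge_var by (simp add: prod.reindex)
        also have "\<dots> = (\<Prod>j<?e. Y j)"
          unfolding Y_def using hs by (intro prod.reindex_bij_betw[symmetric])
        finally show ?thesis using sY by (simp add: subst_prod)
      qed
      moreover have "subst spec g = F (edge_var (hs 0)) ^ (s - 1)"
        using s(2) hs_in[of 0] F_edge_var[of "hs 0"] by (auto simp: g_def subst_power f_def)
      ultimately have "(\<Prod>x\<in>edge_var ` H. Var x) * F (edge_var (hs 0)) ^ (s - 1) \<in> ideal_power (ideal_gen (range F)) s"
        by (simp add: subst_diff subst_mult r0)
      then show False
        using triangular_quadrics.squarefree_times_power_notin[OF triangular, of "edge_var ` H" "s - 1" s] s(1)
        by simp
    qed
  qed
  then show ?thesis by (rule flag_setup.Tor_nonzero)
qed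

end

lemma reg_bound_from_colouring:
  fixes E :: "'v::finite set set" and c :: "'v set \<Rightarrow> 'd::finite"
  assumes g: "simple_graph E" and col: "concave_colouring (induced_edges E W) c w"
    and s: "s \<ge> 1" "induced_edges E W \<noteq> {} \<or> s = 1"
  shows "ereal (real (2 * (s - 1) + card (induced_edges E W)))
    \<le> reg_quotient (ideal_power (LSS_ideal E :: ('v \<times> 'd, 'k::field) mpoly set) s)"
proof -
  let ?H = "induced_edges E W"
  have "\<forall>h. \<exists>pq. h \<in> ?H \<longrightarrow> h = {fst pq, snd pq} \<and> fst pq \<noteq> snd pq"
    using g unfolding simple_graph_def induced_edges_def by (auto simp: card_2_iff)
  from choice[OF this] obtain pq where pq:
    "\<And>h. h \<in> ?H \<Longrightarrow> h = {fst (pq h), snd (pq h)} \<and> fst (pq h) \<noteq> snd (pq h)" by blast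
  obtain xs where xs: "set xs = ?H" "distinct xs" using finite_distinct_list[of ?H] by auto
  define ys where "ys = sort_key (\<lambda>h. - int (w h)) xs"
  have ys: "set ys = ?H" "distinct ys" "sorted (map (\<lambda>h. - int (w h)) ys)"
    using xs by (simp_all add: ys_def)
  have len: "length ys = card ?H" using ys by (metis distinct_card)
  have "coloured_induced_subgraph E W ?H c w (\<lambda>h. fst (pq h)) (\<lambda>h. snd (pq h)) (\<lambda>a. ys ! a)"
  proof
    show "bij_betw ((!) ys) {..<card ?H} ?H"
      using ys(1,2) len by (intro bij_betw_nth) auto
    show "w (ys ! b) \<le> w (ys ! a)" if "a \<le> b" "b < card ?H" for a b
      using sorted_nth_mono[OF ys(3), of a b] that len by simp
    show "h = {fst (pq h), snd (pq h)} \<and> fst (pq h) \<noteq> snd (pq h)" if "h \<in> ?H" for h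
      by (rule pq[OF that])
  qed (rule refl, rule col)
  then have "Tor_nonzero (ideal_power (LSS_ideal E :: ('v \<times> 'd, 'k) mpoly set) s) (card ?H)
      (int (2 * (s - 1)) + 2 * int (card ?H))"
    using s by (intro coloured_induced_subgraph.Tor_nonzero_LSS) (auto simp: card_gt_0_iff)
  then have "ereal (of_int (int (2 * (s - 1)) + 2 * int (card ?H) - int (card ?H)))
      \<le> reg_quotient (ideal_power (LSS_ideal E :: ('v \<times> 'd, 'k) mpoly set) s)"
    unfolding reg_quotient_def by (intro Sup_upper) blast
  then show ?thesis by (simp add: add.commute)
qed

lemma induced_single_vertex:
  assumes "simple_graph E"
  shows "induced_edges E {v} = {}"
proof -
  have "card e \<noteq> 2" if "e \<subseteq> {v}" for e
    using card_mono[OF _ that] by auto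
  then show ?thesis using assms unfolding simple_graph_def induced_edges_def by blast
qed

lemma induced_by_edge:
  fixes E :: "'v::finite set set"
  assumes "simple_graph E" "h \<in> E"
  shows "induced_edges E h = {h}"
proof -
  have "e = h" if "e \<in> E" "e \<subseteq> h" for e
    using card_subset_eq[OF _ that(2)] assms that(1) unfolding simple_graph_def by auto
  then show ?thesis using assms(2) unfolding induced_edges_def by blast
qed

lemma forest_empty: "forest {}"
  unfolding forest_def using cycle_edges_subset[of _ "{}"] cycle_nonempty[of _ "{}"] by blast

lemma forest_single_edge:
  assumes "card h = 2"
  shows "forest {h}"
proof -
  have False if C: "C \<in> cycles {h}" for C
  proof -
    have "C = {h}" using cycle_edges_subset[OF C] cycle_nonempty[OF C] by blast
    moreover obtain v where "v \<in> h" using assms by fastforce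
    ultimately show False using cycle_vertex_two_edges[OF C, of h v] by simp
  qed
  then show ?thesis unfolding forest_def by blast
qed

lemma max_t_u_attained:
  fixes E :: "'v::finite set set"
  assumes g: "simple_graph E"
  shows "\<exists>W. max_t_u d E = card (induced_edges E W) \<and>
    (forest (induced_edges E W) \<or> unicyclic (induced_edges E W)) \<and>
    (\<forall>v. degree (induced_edges E W) v \<le> d)"
proof -
  have fin: "finite (forest_sizes d E)" "finite (unicyclic_sizes d E)"
    unfolding forest_sizes_def unicyclic_sizes_def by (simp_all add: setcompr_eq_image)
  have "0 \<in> forest_sizes d E"
    unfolding forest_sizes_def using induced_single_vertex[OF g, of undefined] forest_empty
    by (intro CollectI exI[of _ "{undefined}"]) (simp add: max_degree_def degree_def)
  then have "t_inv d E \<in> forest_sizes d E" unfolding t_inv_def using fin by (intro Max_in) auto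
  moreover have "u_inv d E \<in> unicyclic_sizes d E" if "unicyclic_sizes d E \<noteq> {}"
    unfolding u_inv_def using fin that by (intro Max_in)
  ultimately have "max_t_u d E \<in> forest_sizes d E \<union> unicyclic_sizes d E"
    unfolding max_t_u_def by (auto simp: max_def)
  then obtain W where W: "max_t_u d E = card (induced_edges E W)"
      "forest (induced_edges E W) \<or> unicyclic (induced_edges E W)"
      "max_degree W (induced_edges E W) \<le> d"
    unfolding forest_sizes_def unicyclic_sizes_def by blast
  have "degree (induced_edges E W) v \<le> d" for v
  proof (cases "v \<in> W")
    case True
    then have "degree (induced_edges E W) v \<le> max_degree W (induced_edges E W)"
      unfolding max_degree_def by (intro Max_ge) auto
    then show ?thesis using W(3) by simp
  next
    case False
    then have "{e \<in> induced_edges E W. v \<in> e} = {}" unfolding induced_edges_def by blast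
    then show ?thesis unfolding degree_def by (metis card.empty zero_le)
  qed
  then show ?thesis using W by blast
qed

text \<open>
  For \<open>s > 1\<close> the construction needs an edge of \<open>H\<close>, whose quadric is raised to the power \<open>s - 1\<close>.
\<close>
lemma max_t_u_positive:
  fixes E :: "'v::finite set set"
  assumes g: "simple_graph E" and "E \<noteq> {}" and d: "1 \<le> d"
  shows "1 \<le> max_t_u d E"
proof -
  have fin: "finite (forest_sizes d E)"
    unfolding forest_sizes_def by (simp add: setcompr_eq_image)
  obtain h where h: "h \<in> E" using assms(2) by blast
  have c: "card h = 2" using g h unfolding simple_graph_def by blast
  have "degree {h} v \<le> 1" for v
    using card_mono[of "{h}" "{e \<in> {h}. v \<in> e}"] unfolding degree_def by auto
  then have "max_degree h {h} \<le> d"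
    using c d unfolding max_degree_def by (subst Max_le_iff) (auto intro: le_trans)
  then have "1 \<in> forest_sizes d E"
    unfolding forest_sizes_def using c induced_by_edge[OF g h] forest_single_edge[OF c]
    by (intro CollectI exI[of _ h] conjI) (simp, force, simp, simp)
  then have "1 \<le> t_inv d E" unfolding t_inv_def using fin by (intro Max_ge)
  then show ?thesis unfolding max_t_u_def by auto
qed

theorem corollary4p4:
  fixes E :: "'n::finite set set" and s :: nat
  assumes "simple_graph E"
    and "CARD('d) \<ge> 3"
    and "s \<ge> 1"
    and "E \<noteq> {} \<or> s = 1"
  shows "reg_quotient (ideal_power (LSS_ideal E :: ('n \<times> 'd::finite, 'k::field) mpoly set) s)
           \<ge> ereal (real (2 * (s - 1) + max_t_u CARD('d) E))"
proof -
  obtain W where W: "max_t_u CARD('d) E = card (induced_edges E W)"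
      "forest (induced_edges E W) \<or> unicyclic (induced_edges E W)"
      "\<And>v. degree (induced_edges E W) v \<le> CARD('d)"
    using max_t_u_attained[OF assms(1)] by blast
  have "simple_graph (induced_edges E W)"
    using simple_graph_subset[OF assms(1)] by (simp add: induced_edges_def)
  then obtain c :: "'n set \<Rightarrow> 'd" and w where "concave_colouring (induced_edges E W) c w"
    using concave_colouring_exists[OF _ assms(2) W(3,2)] by blast
  moreover have "induced_edges E W \<noteq> {} \<or> s = 1"
    using max_t_u_positive[OF assms(1), of "CARD('d)"] assms(2,4) W(1) by fastforce
  ultimately show ?thesis
    using reg_bound_from_colouring[OF assms(1) _ assms(3)] W(1) by metis
qed

end
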